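(* Let $W\ge0$ be a function on $\mathbb Z^d$, $d\ge3$. Suppose that $\mathbf W=\mathcal JW$ is a Hardy weight on $\mathbb R^d$. Then $W$ is a Hardy weight on $\mathbb Z^d$, and $H(W)\le C\,H(\mathbf W)$ with a constant $C$ depending only on $d$. In particular, any non-negative $W\in\ell_{\frac d2,w}(\mathbb Z^d)$ is a Hardy weight on $\mathbb Z^d$, with $H(W)\le C(d)\,\|W\|_{\ell_{\frac d2,w}(\mathbb Z^d)}$.
   Context: For a function $u$ on $\mathbb Z^d$ put $Q_0[u]=\sum_{x\in\mathbb Z^d}\sum_{j=1}^d|u(x+1_j)-u(x)|^2$, where $1_j$ is the $j$-th standard basis vector. For $d\ge3$, $\mathcal H^1(\mathbb Z^d)$ is the completion of the set of finitely supported functions on $\mathbb Z^d$ in the metric generated by $Q_0$; it is a Hilbert space of functions on $\mathbb Z^d$. A function $W\ge0$ on $\mathbb Z^d$ is a Hardy weight on $\mathbb Z^d$ if for some finite constant $H$ one has $\sum_{x\in\mathbb Z^d}W(x)|u(x)|^2\le H\,Q_0[u]$ for all $u\in\mathcal H^1(\mathbb Z^d)$; the best possible constant is the Hardy constant $H(W)$. $\mathcal H^1(\mathbb R^d)$, $d\ge3$, is the homogeneous Sobolev space, with metric given by the Dirichlet integral $\int_{\mathbb R^d}|\nabla U|^2d\xi$ (the completion of $C_0^\infty(\mathbb R^d)$). A function $\mathbf W\ge0$ on $\mathbb R^d$ is a Hardy weight on $\mathbb R^d$ if there is a finite constant $H$ such that $\int_{\mathbb R^d}\mathbf W|U|^2d\xi\le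 H\int_{\mathbb R^d}|\nabla U|^2d\xi$ for all $U\in\mathcal H^1(\mathbb R^d)$; the best possible constant is denoted $H(\mathbf W)$. For $W\ge0$ on $\mathbb Z^d$, $\mathcal JW$ is the function on $\mathbb R^d$ equal to $W(x)$ on the unit cell $[0,1]^d+x$ for each $x\in\mathbb Z^d$ (values on cell boundaries are irrelevant). The space $\ell_{q,w}(\mathbb Z^d)$ (weak $\ell_q$) consists of the functions $W$ on $\mathbb Z^d$, tending to $0$ at infinity, with finite quasi-norm $\|W\|_{\ell_{q,w}}=\sup_{s>0}s\,\nu(s,W)^{1/q}$, where $\nu(s,W)=\#\{x\in\mathbb Z^d:|W(x)|>s\}$. *)

theory Defs
  imports "HOL-Analysis.Analysis"
begin

text \<open>The lattice is \<open>int ^ 'd\<close> and Euclidean space is \<open>real ^ 'd\<close>, with dimension \<open>CARD('d)\<close>.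
  Functions in the energy spaces are complex-valued; quadratic forms take values in \<open>ennreal\<close>.\<close>

subsection \<open>The lattice\<close>

definition Q0 :: "(int ^ 'd::finite \<Rightarrow> complex) \<Rightarrow> ennreal" where
  "Q0 u = (\<Sum>\<^sub>\<infinity>x. \<Sum>j\<in>UNIV. ennreal ((cmod (u (x + axis j 1) - u x))\<^sup>2))"

text \<open>Concrete function model of the completion of the finitely supported functions under
  \<open>Q0\<close>.  Since \<open>Q0\<close> vanishes on constants, convergence in energy alone would determine the limit
  only up to a constant; pointwise convergence fixes it.  For dimension at least 3, point
  evaluations are bounded by the energy, so every \<open>Q0\<close>-Cauchy sequence converges pointwise.\<close>

definition H1_lattice :: "(int ^ 'd::finite \<Rightarrow> complex) set" where
  "H1_lattice = {u. \<exists>\<phi> :: nat \<Rightarrow> int ^ 'd \<Rightarrow> complex.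
     (\<forall>n. finite {x. \<phi> n x \<noteq> 0}) \<and>
     (\<forall>x. (\<lambda>n. \<phi> n x) \<longlonglongrightarrow> u x) \<and>
     (\<lambda>n. Q0 (\<lambda>x. \<phi> n x - u x)) \<longlonglongrightarrow> 0}"

definition hardy_bounds_lattice :: "(int ^ 'd::finite \<Rightarrow> real) \<Rightarrow> real set" where
  "hardy_bounds_lattice W = {H. 0 \<le> H \<and>
     (\<forall>u\<in>H1_lattice. (\<Sum>\<^sub>\<infinity>x. ennreal (W x * (cmod (u x))\<^sup>2)) \<le> ennreal H * Q0 u)}"

definition hardy_weight_lattice :: "(int ^ 'd::finite \<Rightarrow> real) \<Rightarrow> bool" where
  "hardy_weight_lattice W \<longleftrightarrow> (\<forall>x. 0 \<le> W x) \<and> hardy_bounds_lattice W \<noteq> {}"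

text \<open>Meaningful for Hardy weights only.\<close>

definition hardy_const_lattice :: "(int ^ 'd::finite \<Rightarrow> real) \<Rightarrow> real" where
  "hardy_const_lattice W = Inf (hardy_bounds_lattice W)"

subsection \<open>Euclidean space\<close>

definition partial_deriv :: "'d::finite \<Rightarrow> (real ^ 'd \<Rightarrow> complex) \<Rightarrow> real ^ 'd \<Rightarrow> complex" where
  "partial_deriv j f \<xi> = frechet_derivative f (at \<xi>) (axis j 1)"

definition gradient :: "(real ^ 'd::finite \<Rightarrow> complex) \<Rightarrow> real ^ 'd \<Rightarrow> complex ^ 'd" where
  "gradient f \<xi> = (\<chi> j. partial_deriv j f \<xi>)"

primrec Ck :: "nat \<Rightarrow> (real ^ 'd::finite \<Rightarrow> complex) \<Rightarrow> bool" where
  "Ck 0 f \<longleftrightarrow> continuous_on UNIV f"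
| "Ck (Suc k) f \<longleftrightarrow> (\<forall>\<xi>. f differentiable (at \<xi>)) \<and> (\<forall>j. Ck k (partial_deriv j f))"

definition test_function :: "(real ^ 'd::finite \<Rightarrow> complex) \<Rightarrow> bool" where
  "test_function f \<longleftrightarrow> (\<forall>k. Ck k f) \<and> compact (closure {\<xi>. f \<xi> \<noteq> 0})"

text \<open>\<open>H1_gradient U G\<close>: the function \<open>U\<close> represents an element of the completion of the test
  functions in the Dirichlet norm, and \<open>G\<close> is its gradient, i.e. the \<open>L\<^sup>2\<close> limit of the gradients
  of the approximating test functions.  For dimension at least 3, by the Sobolev inequality, every
  Dirichlet-Cauchy sequence has a subsequence converging almost everywhere, and \<open>U\<close> and \<open>G\<close>
  determine each other up to null sets.\<close>

definition H1_gradient ::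
    "(real ^ 'd::finite \<Rightarrow> complex) \<Rightarrow> (real ^ 'd \<Rightarrow> complex ^ 'd) \<Rightarrow> bool" where
  "H1_gradient U G \<longleftrightarrow> U \<in> borel_measurable lebesgue \<and> G \<in> borel_measurable lebesgue \<and>
     (\<exists>\<phi>. (\<forall>n::nat. test_function (\<phi> n)) \<and>
        (AE \<xi> in lebesgue. (\<lambda>n. \<phi> n \<xi>) \<longlonglongrightarrow> U \<xi>) \<and>
        (\<lambda>n. \<integral>\<^sup>+\<xi>. ennreal ((norm (gradient (\<phi> n) \<xi> - G \<xi>))\<^sup>2) \<partial>lebesgue) \<longlonglongrightarrow> 0)"

definition hardy_bounds_euclidean :: "(real ^ 'd::finite \<Rightarrow> real) \<Rightarrow> real set" where
  "hardy_bounds_euclidean V = {H. 0 \<le> H \<and>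
     (\<forall>U G. H1_gradient U G \<longrightarrow>
        (\<integral>\<^sup>+\<xi>. ennreal (V \<xi> * (cmod (U \<xi>))\<^sup>2) \<partial>lebesgue)
          \<le> ennreal H * (\<integral>\<^sup>+\<xi>. ennreal ((norm (G \<xi>))\<^sup>2) \<partial>lebesgue))}"

definition hardy_weight_euclidean :: "(real ^ 'd::finite \<Rightarrow> real) \<Rightarrow> bool" where
  "hardy_weight_euclidean V \<longleftrightarrow>
     V \<in> borel_measurable lebesgue \<and> (\<forall>\<xi>. 0 \<le> V \<xi>) \<and> hardy_bounds_euclidean V \<noteq> {}"

definition hardy_const_euclidean :: "(real ^ 'd::finite \<Rightarrow> real) \<Rightarrow> real" where
  "hardy_const_euclidean V = Inf (hardy_bounds_euclidean V)"

subsection \<open>Extension to cells and weak sequence spaces\<close>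

text \<open>The value on cell boundaries, a null set, is chosen by using half-open cells.\<close>

definition cell_extension :: "(int ^ 'd::finite \<Rightarrow> real) \<Rightarrow> real ^ 'd \<Rightarrow> real" where
  "cell_extension W \<xi> = W (\<chi> j. \<lfloor>\<xi> $ j\<rfloor>)"

definition distribution_count :: "real \<Rightarrow> (int ^ 'd::finite \<Rightarrow> real) \<Rightarrow> nat" where
  "distribution_count s W = card {x. \<bar>W x\<bar> > s}"

text \<open>Tending to 0 at infinity on the lattice is convergence along the cofinite filter; it makes
  the sets counted by \<open>distribution_count s W\<close> finite for \<open>s > 0\<close>.\<close>

definition weak_lq :: "real \<Rightarrow> (int ^ 'd::finite \<Rightarrow> real) set" where
  "weak_lq q = {W. (W \<longlongrightarrow> 0) cofinite \<and>
     bdd_above ((\<lambda>s. s * real (distribution_count s W) powr (1 / q)) ` {0<..})}"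

definition weak_lq_norm :: "real \<Rightarrow> (int ^ 'd::finite \<Rightarrow> real) \<Rightarrow> real" where
  "weak_lq_norm q W = (SUP s\<in>{0<..}. s * real (distribution_count s W) powr (1 / q))"

end

theory Submission
  imports Defs "HOL-Computational_Algebra.Polynomial"
begin

text \<open>
  The proof has two independent halves, which share one reduction: it suffices to prove
  \<open>\<Sum> W |\<phi>|\<^sup>2 \<le> K Q0[\<phi>]\<close> for finitely supported \<open>\<phi>\<close>.  Elements of \<open>H1_lattice\<close> are
  pointwise limits of such \<open>\<phi>\<close> whose energies converge, so the inequality survives the limit,
  at the harmless cost of a factor 2 (lemma \<open>hardy_lattice_from_finite_support\<close>).

  \<^emph>\<open>From the Euclidean weight to the lattice.\<close>  A lattice function \<open>u\<close> is interpolated by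
  \<open>U(\<xi>) = \<Sum> u(x) \<Prod> \<eta>(\<xi>\<^sub>j - x\<^sub>j)\<close>, where \<open>\<eta>\<close> is a smooth bump on the line whose integer translates
  form a partition of unity and which equals 1 on the middle third of \<open>[0, 1]\<close>.  Then \<open>U\<close> is a test
  function that equals \<open>u(x)\<close> on the middle cube of the cell of \<open>x\<close>, so that
  \<open>3^(-d) \<Sum> W |u|\<^sup>2 \<le> \<integral> JW |U|\<^sup>2\<close>.  Because the translates sum to a constant, their gradients sum to
  zero, and \<open>\<nabla>U\<close> on a cell is a combination of differences of \<open>u\<close> between neighbouring lattice
  points; hence \<open>\<integral> |\<nabla>U|\<^sup>2 \<le> K Q0[u]\<close>.  Inserting \<open>U\<close> into the Euclidean Hardy inequality gives the
  claim.  Interpolating by a smooth function instead of a multilinear one makes \<open>U\<close> a test function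
  without any approximation.

  \<^emph>\<open>Weak sequence spaces.\<close>  This half stays on the lattice.  Three facts combine.
  The isocapacitary inequality \<open>(card A)^(1 - 2/d) \<le> C Q0[v]\<close>, valid when \<open>|v| \<ge> 1\<close> on \<open>A\<close>, comes
  from comparing \<open>v\<close> with its means over dyadic cubes: translating \<open>v\<close> by a vector of length \<open>r\<close>
  changes it by \<open>O(r Q0[v]^(1/2))\<close> in \<open>\<ell>\<^sup>2\<close>, so the means approximate \<open>v\<close> in \<open>\<ell>\<^sup>2\<close> at small scales and
  are uniformly small at large scales, the latter because \<open>d \<ge> 3\<close>.
  Next, a weight of weak norm \<open>N\<close> satisfies \<open>\<Sum> W \<le> C N (card A)^(1 - 2/d)\<close> over every finite set \<open>A\<close>.
  Finally Maz'ya's truncation argument cuts \<open>|\<phi>|\<close> into dyadic layers.  The energies of the layers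
  add up to at most \<open>Q0[\<phi>]\<close>, and applying the first two facts to each layer bounds
  \<open>\<Sum> W |\<phi>|\<^sup>2\<close> by a multiple of \<open>N Q0[\<phi>]\<close>.
\<close>

section \<open>Energy of finitely supported functions\<close>

text \<open>
  Real-valued counterpart of \<open>Q0\<close> over finitely many base points; it equals \<open>Q0\<close> when \<open>B\<close> contains
  the lower end point of every edge along which \<open>u\<close> varies.
\<close>
definition edge_energy :: "(int ^ 'd::finite) set \<Rightarrow> (int ^ 'd \<Rightarrow> complex) \<Rightarrow> real" where
  "edge_energy B u = (\<Sum>x\<in>B. \<Sum>j\<in>UNIV. (cmod (u (x + axis j 1) - u x))\<^sup>2)"

lemma edge_energy_le_Q0:
  assumes "finite B"
  shows "ennreal (edge_energy B u) \<le> Q0 u"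
proof -
  have "ennreal (edge_energy B u) = (\<Sum>x\<in>B. \<Sum>j\<in>UNIV. ennreal ((cmod (u (x + axis j 1) - u x))\<^sup>2))"
    unfolding edge_energy_def by (simp add: sum_nonneg)
  also have "\<dots> \<le> Q0 u"
    unfolding Q0_def by (subst nonneg_infsum_complete) (auto intro!: SUP_upper assms)
  finally show ?thesis .
qed

lemma Q0_leI:
  assumes "\<And>B. finite B \<Longrightarrow> ennreal (edge_energy B u) \<le> c"
  shows "Q0 u \<le> c"
  unfolding Q0_def
proof (rule infsum_le_finite_sums)
  show "(\<lambda>x. \<Sum>j\<in>UNIV. ennreal ((cmod (u (x + axis j 1) - u x))\<^sup>2)) summable_on UNIV"
    by (auto intro: nonneg_summable_on_complete)
  fix B :: "(int ^ 'a) set" assume "finite B"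
  then show "(\<Sum>x\<in>B. \<Sum>j\<in>UNIV. ennreal ((cmod (u (x + axis j 1) - u x))\<^sup>2)) \<le> c"
    using assms[of B] by (simp add: edge_energy_def sum_nonneg)
qed

lemma Q0_eq_edge_energy:
  assumes "finite B" and "\<And>x j. u (x + axis j 1) \<noteq> u x \<Longrightarrow> x \<in> B"
  shows "Q0 u = ennreal (edge_energy B u)"
proof (rule antisym)
  show "Q0 u \<le> ennreal (edge_energy B u)"
  proof (rule Q0_leI)
    fix F :: "(int ^ 'a) set" assume F: "finite F"
    have "edge_energy F u = edge_energy (F \<inter> B) u"
      unfolding edge_energy_def
    proof (rule sum.mono_neutral_right)
      show "\<forall>x\<in>F - F \<inter> B. (\<Sum>j\<in>UNIV. (cmod (u (x + axis j 1) - u x))\<^sup>2) = 0"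
        using assms(2) by (intro ballI sum.neutral) (metis DiffD1 DiffD2 IntI diff_self norm_zero power_zero_numeral)
    qed (use F in auto)
    also have "\<dots> \<le> edge_energy B u"
      unfolding edge_energy_def by (rule sum_mono2) (use assms(1) in \<open>auto intro: sum_nonneg\<close>)
    finally show "ennreal (edge_energy F u) \<le> ennreal (edge_energy B u)"
      by (rule ennreal_leI)
  qed
qed (rule edge_energy_le_Q0[OF assms(1)])

lemma finite_edges_of_finite_support:
  fixes u :: "int ^ 'd::finite \<Rightarrow> complex"
  assumes "finite {x. u x \<noteq> 0}"
  obtains B where "finite B" "\<And>x j. x + axis j 1 \<in> {x. u x \<noteq> 0} \<or> u x \<noteq> 0 \<Longrightarrow> x \<in> B"
proof
  let ?S = "{x. u x \<noteq> 0}"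
  let ?B = "?S \<union> (\<Union>j\<in>UNIV. (\<lambda>y. y - axis j 1) ` ?S)"
  show "finite ?B" using assms by auto
  show "x \<in> ?B" if "x + axis j 1 \<in> ?S \<or> u x \<noteq> 0" for x j
  proof (cases "u x = 0")
    case True
    then have "x + axis j 1 \<in> ?S" using that by blast
    then have "x + axis j 1 - axis j 1 \<in> (\<lambda>y. y - axis j 1) ` ?S" by (rule imageI)
    then show ?thesis by auto
  qed simp
qed

lemma edge_energy_nonneg: "0 \<le> edge_energy B u"
  unfolding edge_energy_def by (intro sum_nonneg) auto

lemma Q0_finite_support:
  assumes "finite {x. u x \<noteq> 0}"
  obtains E where "0 \<le> E" "Q0 u = ennreal E"
proof -
  obtain B where "finite B" "\<And>x j. x + axis j 1 \<in> {x. u x \<noteq> 0} \<or> u x \<noteq> 0 \<Longrightarrow> x \<in> B"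
    using finite_edges_of_finite_support[OF assms] by blast
  then have "Q0 u = ennreal (edge_energy B u)"
    by (intro Q0_eq_edge_energy) force+
  with that edge_energy_nonneg show thesis by blast
qed

lemma Q0_add_le: "Q0 (\<lambda>x. a x + b x) \<le> 2 * Q0 a + 2 * Q0 b"
proof (rule Q0_leI)
  fix B :: "(int ^ 'a) set" assume B: "finite B"
  have "edge_energy B (\<lambda>x. a x + b x) \<le> 2 * edge_energy B a + 2 * edge_energy B b"
  proof -
    have "(cmod (a y + b y - (a x + b x)))\<^sup>2 \<le> 2 * (cmod (a y - a x))\<^sup>2 + 2 * (cmod (b y - b x))\<^sup>2" for x y
    proof -
      have "cmod (a y + b y - (a x + b x)) \<le> cmod (a y - a x) + cmod (b y - b x)"
        by (metis add_diff_add norm_triangle_ineq)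
      then have "(cmod (a y + b y - (a x + b x)))\<^sup>2 \<le> (cmod (a y - a x) + cmod (b y - b x))\<^sup>2"
        by (simp add: power_mono)
      also have "\<dots> \<le> 2 * (cmod (a y - a x))\<^sup>2 + 2 * (cmod (b y - b x))\<^sup>2"
        using sum_squares_bound[of "cmod (a y - a x)" "cmod (b y - b x)"]
        by (simp add: power2_sum)
      finally show ?thesis .
    qed
    then show ?thesis
      unfolding edge_energy_def sum_distrib_left sum.distrib[symmetric] by (intro sum_mono)
  qed
  then have "ennreal (edge_energy B (\<lambda>x. a x + b x)) \<le> ennreal (2 * edge_energy B a + 2 * edge_energy B b)"
    by (rule ennreal_leI)
  also have "\<dots> = 2 * ennreal (edge_energy B a) + 2 * ennreal (edge_energy B b)"
    by (simp add: edge_energy_nonneg ennreal_mult')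
  also have "\<dots> \<le> 2 * Q0 a + 2 * Q0 b"
    by (intro add_mono mult_left_mono edge_energy_le_Q0 B) auto
  finally show "ennreal (edge_energy B (\<lambda>x. a x + b x)) \<le> 2 * Q0 a + 2 * Q0 b" .
qed

lemma Q0_uminus: "Q0 (\<lambda>x. - u x) = Q0 u"
proof -
  have "cmod (- u y - - u x) = cmod (u y - u x)" for x y
    by (metis minus_diff_minus norm_minus_cancel)
  then show ?thesis unfolding Q0_def by simp
qed


section \<open>Reduction to finitely supported functions\<close>

text \<open>
  If \<open>\<phi>\<^sub>n\<close> approximates \<open>u\<close> in the sense of \<open>H1_lattice\<close>, then
  \<open>Q0[\<phi>\<^sub>n] \<le> 2 Q0[u] + 2 Q0[\<phi>\<^sub>n - u]\<close>, and over a finite set of points the weighted sums converge;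
  the factor 2 of this crude triangle inequality is the one in the conclusion.
\<close>
lemma hardy_bounds_lattice_from_finite_support:
  fixes W :: "int ^ 'd::finite \<Rightarrow> real"
  assumes W: "\<And>x. 0 \<le> W x" and K: "0 \<le> K"
    and bound: "\<And>\<phi> E F. finite {x. \<phi> x \<noteq> 0} \<Longrightarrow> Q0 \<phi> = ennreal E \<Longrightarrow> 0 \<le> E \<Longrightarrow> finite F \<Longrightarrow>
       (\<Sum>x\<in>F. W x * (cmod (\<phi> x))\<^sup>2) \<le> K * E"
  shows "2 * K \<in> hardy_bounds_lattice W"
  unfolding hardy_bounds_lattice_def
proof (intro CollectI conjI ballI)
  show "0 \<le> 2 * K" using K by simp
  fix u :: "int ^ 'd \<Rightarrow> complex" assume "u \<in> H1_lattice"
  then obtain \<phi> :: "nat \<Rightarrow> int ^ 'd \<Rightarrow> complex"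
    where fin: "\<And>n. finite {x. \<phi> n x \<noteq> 0}"
      and lim: "\<And>x. (\<lambda>n. \<phi> n x) \<longlonglongrightarrow> u x"
      and energy: "(\<lambda>n. Q0 (\<lambda>x. \<phi> n x - u x)) \<longlonglongrightarrow> 0"
    unfolding H1_lattice_def by blast
  have small: "\<forall>\<^sub>F n in sequentially. Q0 (\<lambda>x. \<phi> n x - u x) < ennreal e" if "e > 0" for e
    using order_tendstoD(2)[OF energy, of "ennreal e"] that by simp
  have "\<exists>E\<ge>0. Q0 u = ennreal E"
  proof -
    obtain n where n: "Q0 (\<lambda>x. \<phi> n x - u x) < ennreal 1"
      using eventually_happens'[OF _ small[of 1]] by auto
    obtain E' where E': "Q0 (\<phi> n) = ennreal E'" using Q0_finite_support[OF fin[of n]] by metis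
    have "Q0 u = Q0 (\<lambda>x. \<phi> n x + - (\<phi> n x - u x))" by simp
    also have "\<dots> \<le> 2 * Q0 (\<phi> n) + 2 * Q0 (\<lambda>x. - (\<phi> n x - u x))"
      by (rule Q0_add_le)
    also have "\<dots> = 2 * Q0 (\<phi> n) + 2 * Q0 (\<lambda>x. \<phi> n x - u x)"
      using Q0_uminus[of "\<lambda>x. \<phi> n x - u x"] by simp
    also have "\<dots> < top"
    proof -
      have "Q0 (\<lambda>x. \<phi> n x - u x) < top" using n by (rule order.strict_trans) simp
      then show ?thesis
        unfolding E' by (simp add: ennreal_mult_less_top ennreal_numeral_less_top)
    qed
    finally show ?thesis by (cases "Q0 u") auto
  qed
  then obtain E where E: "0 \<le> E" "Q0 u = ennreal E" by auto
  have part: "(\<Sum>x\<in>F. W x * (cmod (u x))\<^sup>2) \<le> 2 * K * E" if F: "finite F" for F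
  proof (rule field_le_epsilon)
    fix e :: real assume e: "e > 0"
    \<comment> \<open>Chosen so that \<open>2 K e' \<le> e\<close> also when \<open>K = 0\<close>.\<close>
    define e' where "e' = e / (2 * (K + 1))"
    have e': "e' > 0" using e K by (simp add: e'_def)
    have "\<forall>\<^sub>F n in sequentially. (\<Sum>x\<in>F. W x * (cmod (\<phi> n x))\<^sup>2) \<le> K * (2 * E + 2 * e')"
      using small[OF e']
    proof eventually_elim
      case (elim n)
      obtain En where En: "0 \<le> En" "Q0 (\<phi> n) = ennreal En" using Q0_finite_support[OF fin[of n]] by metis
      have "ennreal En = Q0 (\<lambda>x. u x + (\<phi> n x - u x))" using En by simp
      also have "\<dots> \<le> 2 * Q0 u + 2 * Q0 (\<lambda>x. \<phi> n x - u x)" by (rule Q0_add_le)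
      also have "\<dots> \<le> 2 * ennreal E + 2 * ennreal e'"
        using elim E by (intro add_mono mult_left_mono) auto
      also have "\<dots> = ennreal (2 * E + 2 * e')"
        using E e' by (simp add: ennreal_mult')
      finally have "En \<le> 2 * E + 2 * e'" using E e' by (subst (asm) ennreal_le_iff) auto
      then show ?case using bound[OF fin En(2,1) F] K by (meson mult_left_mono order_trans)
    qed
    moreover have "(\<lambda>n. \<Sum>x\<in>F. W x * (cmod (\<phi> n x))\<^sup>2) \<longlonglongrightarrow> (\<Sum>x\<in>F. W x * (cmod (u x))\<^sup>2)"
      by (intro tendsto_intros lim)
    ultimately have "(\<Sum>x\<in>F. W x * (cmod (u x))\<^sup>2) \<le> K * (2 * E + 2 * e')"
      by (intro tendsto_upperbound) auto
    also have "\<dots> \<le> 2 * K * E + e"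
    proof -
      have "K * (2 * e') = e * (K / (K + 1))" using K by (simp add: e'_def field_simps)
      also have "\<dots> \<le> e * 1" using K e by (intro mult_left_mono) auto
      finally show ?thesis by (simp add: algebra_simps)
    qed
    finally show "(\<Sum>x\<in>F. W x * (cmod (u x))\<^sup>2) \<le> 2 * K * E + e" .
  qed
  have "(\<Sum>\<^sub>\<infinity>x. ennreal (W x * (cmod (u x))\<^sup>2)) \<le> ennreal (2 * K * E)"
  proof (rule infsum_le_finite_sums)
    fix F :: "(int ^ 'd) set" assume F: "finite F"
    then show "(\<Sum>x\<in>F. ennreal (W x * (cmod (u x))\<^sup>2)) \<le> ennreal (2 * K * E)"
      using part[OF F] W by (simp add: ennreal_leI)
  qed (auto intro: nonneg_summable_on_complete)
  then show "(\<Sum>\<^sub>\<infinity>x. ennreal (W x * (cmod (u x))\<^sup>2)) \<le> ennreal (2 * K) * Q0 u"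
    using E K by (simp add: ennreal_mult)
qed

lemma hardy_lattice_from_finite_support:
  fixes W :: "int ^ 'd::finite \<Rightarrow> real"
  assumes W: "\<And>x. 0 \<le> W x" and K: "0 \<le> K"
    and bound: "\<And>\<phi> E F. finite {x. \<phi> x \<noteq> 0} \<Longrightarrow> Q0 \<phi> = ennreal E \<Longrightarrow> 0 \<le> E \<Longrightarrow> finite F \<Longrightarrow>
       (\<Sum>x\<in>F. W x * (cmod (\<phi> x))\<^sup>2) \<le> K * E"
  shows "hardy_weight_lattice W" "hardy_const_lattice W \<le> 2 * K"
proof -
  have *: "2 * K \<in> hardy_bounds_lattice W"
    using hardy_bounds_lattice_from_finite_support[of W K] assms by blast
  then show "hardy_weight_lattice W" using W by (auto simp: hardy_weight_lattice_def)
  have "bdd_below (hardy_bounds_lattice W)"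
    by (rule bdd_belowI[of _ 0]) (auto simp: hardy_bounds_lattice_def)
  then show "hardy_const_lattice W \<le> 2 * K"
    unfolding hardy_const_lattice_def by (rule cInf_lower[OF *])
qed


section \<open>Translations and the energy\<close>

text \<open>
  A bound on the \<open>\<ell>\<^sup>2\<close> norm of \<open>u(\<cdot> + e) - u\<close>.  Taking the norm over finite sets keeps all sums real,
  and bounding the norm rather than its square makes the bound additive in \<open>e\<close>.
\<close>
definition shift_bounded :: "(int ^ 'd::finite \<Rightarrow> complex) \<Rightarrow> real \<Rightarrow> int ^ 'd \<Rightarrow> bool" where
  "shift_bounded u c e \<longleftrightarrow> (\<forall>A. finite A \<longrightarrow> L2_set (\<lambda>x. cmod (u (x + e) - u x)) A \<le> c)"

lemma L2_set_translate:
  "L2_set (\<lambda>x. f (x + e)) A = L2_set f ((\<lambda>x. x + e) ` A)" for e :: "int ^ 'd::finite"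
  unfolding L2_set_def by (subst sum.reindex) (auto simp: inj_on_def)

lemma shift_bounded_add:
  assumes "shift_bounded u c e" "shift_bounded u c' e'"
  shows "shift_bounded u (c + c') (e + e')"
  unfolding shift_bounded_def
proof (intro allI impI)
  fix A :: "(int ^ 'a) set" assume A: "finite A"
  have "L2_set (\<lambda>x. cmod (u (x + (e + e')) - u x)) A
      \<le> L2_set (\<lambda>x. cmod (u (x + e) - u x) + cmod (u (x + e + e') - u (x + e))) A"
  proof (rule L2_set_mono)
    fix x
    show "cmod (u (x + (e + e')) - u x) \<le> cmod (u (x + e) - u x) + cmod (u (x + e + e') - u (x + e))"
      using norm_triangle_ineq[of "u (x + e) - u x" "u (x + e + e') - u (x + e)"] by (simp add: add.assoc)
  qed auto
  also have "\<dots> \<le> L2_set (\<lambda>x. cmod (u (x + e) - u x)) A + L2_set (\<lambda>x. cmod (u (x + e + e') - u (x + e))) A"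
    by (rule L2_set_triangle_ineq)
  also have "\<dots> \<le> c + c'"
    using assms A unfolding shift_bounded_def
    by (intro add_mono) (auto simp: L2_set_translate[where f = "\<lambda>x. cmod (u (x + e') - u x)"])
  finally show "L2_set (\<lambda>x. cmod (u (x + (e + e')) - u x)) A \<le> c + c'" .
qed

lemma shift_bounded_uminus:
  assumes "shift_bounded u c e"
  shows "shift_bounded u c (- e)"
  unfolding shift_bounded_def
proof (intro allI impI)
  fix A :: "(int ^ 'a) set" assume A: "finite A"
  have "L2_set (\<lambda>x. cmod (u (x + - e) - u x)) A = L2_set (\<lambda>x. (\<lambda>y. cmod (u (y + e) - u y)) (x + - e)) A"
    by (rule L2_set_cong) (auto simp: norm_minus_commute)
  also have "\<dots> \<le> c"
    unfolding L2_set_translate[of "\<lambda>y. cmod (u (y + e) - u y)" "- e" A]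
    using assms A unfolding shift_bounded_def by blast
  finally show "L2_set (\<lambda>x. cmod (u (x + - e) - u x)) A \<le> c" .
qed

lemma shift_bounded_mono: "shift_bounded u c e \<Longrightarrow> c \<le> c' \<Longrightarrow> shift_bounded u c' e"
  unfolding shift_bounded_def by (meson order_trans)

lemma shift_bounded_zero: "shift_bounded u 0 0"
  by (auto simp: shift_bounded_def L2_set_def)

lemma shift_bounded_unit:
  assumes "Q0 u \<le> ennreal E" "0 \<le> E"
  shows "shift_bounded u (sqrt E) (axis j 1)"
  unfolding shift_bounded_def L2_set_def
proof (intro allI impI real_sqrt_le_mono)
  fix A :: "(int ^ 'a) set" assume A: "finite A"
  have "(\<Sum>x\<in>A. (cmod (u (x + axis j 1) - u x))\<^sup>2) \<le> edge_energy A u"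
    unfolding edge_energy_def
    by (intro sum_mono member_le_sum) auto
  also have "\<dots> \<le> E"
    using edge_energy_le_Q0[OF A, of u] assms by (metis ennreal_le_iff order_trans)
  finally show "(\<Sum>x\<in>A. (cmod (u (x + axis j 1) - u x))\<^sup>2) \<le> E" .
qed

lemma shift_bounded_axis:
  assumes "Q0 u \<le> ennreal E" "0 \<le> E" "\<bar>m\<bar> \<le> int n"
  shows "shift_bounded u (real n * sqrt E) (axis j m)"
proof -
  have nat: "shift_bounded u (real k * sqrt E) (axis j (int k))" for k
  proof (induction k)
    case 0
    have "axis j (int 0) = (0 :: int ^ 'a)" by (simp add: vec_eq_iff axis_def)
    then show ?case using shift_bounded_zero[of u] by (simp only:) simp
  next
    case (Suc k)
    have "axis j (int (Suc k)) = (axis j (int k) + axis j 1 :: int ^ 'a)" by (simp add: vec_eq_iff axis_def)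
    moreover have "real (Suc k) * sqrt E = real k * sqrt E + sqrt E" by (simp add: algebra_simps)
    ultimately show ?case
      using shift_bounded_add[OF Suc shift_bounded_unit[OF assms(1,2), of j]] by (simp only:)
  qed
  have mono: "real (nat \<bar>m\<bar>) * sqrt E \<le> real n * sqrt E"
    using assms by (intro mult_right_mono) auto
  show ?thesis
  proof (cases "0 \<le> m")
    case True
    then show ?thesis using shift_bounded_mono[OF nat mono] by simp
  next
    case False
    then have "axis j m = (- axis j (int (nat \<bar>m\<bar>)) :: int ^ 'a)"
      by (simp add: vec_eq_iff axis_def)
    then show ?thesis using shift_bounded_mono[OF shift_bounded_uminus[OF nat] mono] by (simp only:)
  qed
qed

text \<open>
  A vector with coordinates bounded by \<open>n\<close> is reached from the origin in at most \<open>d n\<close> unit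
  steps, each of which costs \<open>sqrt E\<close>.
\<close>
lemma shift_bounded_energy:
  fixes u :: "int ^ 'd::finite \<Rightarrow> complex"
  assumes "Q0 u \<le> ennreal E" "0 \<le> E" "\<And>j. \<bar>e $ j\<bar> \<le> int n"
  shows "shift_bounded u (real CARD('d) * real n * sqrt E) e"
proof -
  have *: "shift_bounded u (real (card J) * real n * sqrt E) (\<Sum>j\<in>J. axis j (e $ j))" if "finite J" for J
    using that
  proof (induction J)
    case empty
    then show ?case using shift_bounded_zero by simp
  next
    case (insert j J)
    have "real (card (insert j J)) * real n * sqrt E = real n * sqrt E + real (card J) * real n * sqrt E"
      using insert.hyps by (simp add: algebra_simps)
    with insert.hyps show ?case
      using shift_bounded_add[OF shift_bounded_axis[OF assms(1,2) assms(3)[of j], of j] insert.IH]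
      by (simp only: sum.insert[OF insert.hyps])
  qed
  have "(\<Sum>j\<in>UNIV. axis j (e $ j)) $ i = e $ i" for i
    by (simp only: sum_component axis_def vec_lambda_beta) (simp add: if_distrib)
  then have "(\<Sum>j\<in>UNIV. axis j (e $ j)) = e"
    by (simp only: vec_eq_iff) simp
  then show ?thesis using *[of UNIV] by simp
qed

lemma sum_shift_energy_le:
  fixes u :: "int ^ 'd::finite \<Rightarrow> complex"
  assumes "Q0 u \<le> ennreal E" "0 \<le> E" "\<And>j. \<bar>e $ j\<bar> \<le> int n" "finite A"
  shows "(\<Sum>x\<in>A. (cmod (u (x + e) - u x))\<^sup>2) \<le> (real CARD('d) * real n)\<^sup>2 * E"
proof -
  have "L2_set (\<lambda>x. cmod (u (x + e) - u x)) A \<le> real CARD('d) * real n * sqrt E"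
    using shift_bounded_energy[OF assms(1-3)] assms(4) unfolding shift_bounded_def by blast
  then have "(L2_set (\<lambda>x. cmod (u (x + e) - u x)) A)\<^sup>2 \<le> (real CARD('d) * real n * sqrt E)\<^sup>2"
    by (rule power_mono) simp
  then show ?thesis
    using assms(2) by (simp add: L2_set_def sum_nonneg power_mult_distrib)
qed


section \<open>Cubes in the lattice\<close>

definition lattice_box :: "int set \<Rightarrow> (int ^ 'd::finite) set" where
  "lattice_box B = {e. \<forall>j. e $ j \<in> B}"

lemma bij_betw_lattice_box:
  "bij_betw vec_nth (lattice_box B :: (int ^ 'd::finite) set) (PiE UNIV (\<lambda>_. B))"
  unfolding bij_betw_def
proof
  show "inj_on vec_nth (lattice_box B :: (int ^ 'd) set)"
    by (auto simp: inj_on_def vec_eq_iff)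
  have "f \<in> vec_nth ` (lattice_box B :: (int ^ 'd) set)" if "f \<in> PiE UNIV (\<lambda>_. B)" for f
    by (rule image_eqI[of _ _ "\<chi> j. f j"]) (use that in \<open>auto simp: lattice_box_def PiE_def\<close>)
  then show "vec_nth ` (lattice_box B :: (int ^ 'd) set) = PiE UNIV (\<lambda>_. B)"
    by (auto simp: lattice_box_def)
qed

lemma finite_lattice_box: "finite B \<Longrightarrow> finite (lattice_box B :: (int ^ 'd::finite) set)"
  using bij_betw_finite[OF bij_betw_lattice_box] finite_PiE[of "UNIV :: 'd set" "\<lambda>_. B"] by auto

lemma card_lattice_box: "card (lattice_box B :: (int ^ 'd::finite) set) = card B ^ CARD('d)"
  using bij_betw_same_card[OF bij_betw_lattice_box[where 'd = 'd, of B]] by (simp add: card_PiE)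

text \<open>
  Turns a sum of tensor products over neighbouring lattice points into a product of one-dimensional
  sums, a single one of which then decides whether the whole vanishes.
\<close>
lemma sum_lattice_box_prod:
  fixes f :: "'d::finite \<Rightarrow> int \<Rightarrow> 'a::comm_semiring_1"
  assumes "finite B"
  shows "(\<Sum>e\<in>lattice_box B. \<Prod>j\<in>UNIV. f j (e $ j)) = (\<Prod>j\<in>UNIV. \<Sum>k\<in>B. f j k)"
  using sum.reindex_bij_betw[OF bij_betw_lattice_box, of "\<lambda>h. \<Prod>j\<in>UNIV. f j (h j)" B]
  by (simp add: prod_sum_PiE assms)

section \<open>A smooth partition of unity on the line\<close>

text \<open>
  The derivative is quantified existentially so that the closure properties below can supply it in
  closed form.
\<close>
primrec differentiable_times :: "nat \<Rightarrow> (real \<Rightarrow> real) \<Rightarrow> bool" where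
  "differentiable_times 0 f \<longleftrightarrow> continuous_on UNIV f"
| "differentiable_times (Suc k) f \<longleftrightarrow>
     (\<exists>f'. (\<forall>t. (f has_real_derivative f' t) (at t)) \<and> differentiable_times k f')"

definition smooth :: "(real \<Rightarrow> real) \<Rightarrow> bool" where
  "smooth f \<longleftrightarrow> (\<forall>k. differentiable_times k f)"

lemma differentiable_times_SucD: "differentiable_times (Suc k) f \<Longrightarrow> differentiable_times k f"
proof (induction k arbitrary: f)
  case 0
  then obtain f' where "\<forall>t. (f has_real_derivative f' t) (at t)" by auto
  then show ?case by (metis continuous_at_imp_continuous_on DERIV_isCont differentiable_times.simps(1))
next
  case (Suc k)
  then show ?case by (metis differentiable_times.simps(2))
qed

lemma smooth_has_deriv:
  assumes "smooth f"
  shows "(f has_real_derivative deriv f t) (at t)" and "smooth (deriv f)"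
proof -
  have *: "(\<forall>t. (f has_real_derivative deriv f t) (at t)) \<and> differentiable_times k (deriv f)" for k
  proof -
    obtain f' where f': "\<forall>t. (f has_real_derivative f' t) (at t)" "differentiable_times k f'"
      using assms by (metis smooth_def differentiable_times.simps(2))
    then have "deriv f = f'" by (auto intro: DERIV_imp_deriv)
    with f' show ?thesis by simp
  qed
  then show "(f has_real_derivative deriv f t) (at t)" "smooth (deriv f)"
    by (auto simp: smooth_def)
qed

lemma smooth_continuous_on: "smooth f \<Longrightarrow> continuous_on A f"
  by (metis smooth_def differentiable_times.simps(1) continuous_on_subset subset_UNIV)

lemma differentiable_times_const: "differentiable_times k (\<lambda>t. c)"
  by (induction k arbitrary: c) (auto intro: exI[of _ "\<lambda>t. 0"])

lemma differentiable_times_add: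
  "differentiable_times k f \<Longrightarrow> differentiable_times k g \<Longrightarrow> differentiable_times k (\<lambda>t. f t + g t)"
proof (induction k arbitrary: f g)
  case 0
  then show ?case by (auto intro: continuous_intros)
next
  case (Suc k)
  then obtain f' g' where "\<forall>t. (f has_real_derivative f' t) (at t)" "differentiable_times k f'"
    "\<forall>t. (g has_real_derivative g' t) (at t)" "differentiable_times k g'" by auto
  then show ?case using Suc.IH by (auto intro!: exI[of _ "\<lambda>t. f' t + g' t"] derivative_intros)
qed

lemma differentiable_times_mult:
  "differentiable_times k f \<Longrightarrow> differentiable_times k g \<Longrightarrow> differentiable_times k (\<lambda>t. f t * g t)"
proof (induction k arbitrary: f g)
  case 0
  then show ?case by (auto intro: continuous_intros)
next
  case (Suc k)
  then obtain f' g' where "\<forall>t. (f has_real_derivative f' t) (at t)" "differentiable_times k f'"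
    "\<forall>t. (g has_real_derivative g' t) (at t)" "differentiable_times k g'" by auto
  moreover have "differentiable_times k f" "differentiable_times k g"
    using Suc.prems by (blast intro: differentiable_times_SucD)+
  ultimately show ?case using Suc.IH
    by (auto intro!: exI[of _ "\<lambda>t. f' t * g t + g' t * f t"] DERIV_mult differentiable_times_add)
qed

lemma differentiable_times_inverse:
  "differentiable_times k f \<Longrightarrow> (\<And>t. f t \<noteq> 0) \<Longrightarrow> differentiable_times k (\<lambda>t. inverse (f t))"
proof (induction k arbitrary: f)
  case 0
  then show ?case by (auto intro: continuous_intros)
next
  case (Suc k)
  then obtain f' where f': "\<forall>t. (f has_real_derivative f' t) (at t)" "differentiable_times k f'" by auto
  have "differentiable_times k (\<lambda>t. inverse (f t))"
    using Suc.IH[OF differentiable_times_SucD[OF Suc.prems(1)]] Suc.prems(2) by simp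
  then have "differentiable_times k (\<lambda>t. (- 1) * (inverse (f t) * f' t * inverse (f t)))"
    using f' by (intro differentiable_times_mult differentiable_times_const)
  moreover have "((\<lambda>t. inverse (f t)) has_real_derivative (- 1) * (inverse (f t) * f' t * inverse (f t))) (at t)" for t
    using DERIV_inverse'[of f "f' t" t UNIV] f' Suc.prems(2) by simp
  ultimately show ?case
    unfolding differentiable_times.simps
    by (intro exI[of _ "\<lambda>t. (- 1) * (inverse (f t) * f' t * inverse (f t))"]) blast
qed

lemma differentiable_times_affine:
  "differentiable_times k f \<Longrightarrow> differentiable_times k (\<lambda>t. f (a * t + b))"
proof (induction k arbitrary: f)
  case 0
  then show ?case by (auto intro!: continuous_on_compose2[of UNIV f] continuous_intros)
next
  case (Suc k)
  then obtain f' where f': "\<forall>t. (f has_real_derivative f' t) (at t)" "differentiable_times k f'" by auto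
  have "((\<lambda>t. f (a * t + b)) has_real_derivative f' (a * t + b) * a) (at t)" for t
    by (rule DERIV_chain2[of f]) (use f' in \<open>auto intro!: derivative_eq_intros\<close>)
  then show ?case using Suc.IH[OF f'(2)]
    by (auto intro!: exI[of _ "\<lambda>t. f' (a * t + b) * a"] differentiable_times_mult differentiable_times_const)
qed

lemma smooth_add: "smooth f \<Longrightarrow> smooth g \<Longrightarrow> smooth (\<lambda>t. f t + g t)"
  and smooth_mult: "smooth f \<Longrightarrow> smooth g \<Longrightarrow> smooth (\<lambda>t. f t * g t)"
  and smooth_inverse: "smooth f \<Longrightarrow> (\<And>t. f t \<noteq> 0) \<Longrightarrow> smooth (\<lambda>t. inverse (f t))"
  and smooth_affine: "smooth f \<Longrightarrow> smooth (\<lambda>t. f (a * t + b))"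
  and smooth_const: "smooth (\<lambda>t. c)"
  by (simp_all add: smooth_def differentiable_times_add differentiable_times_mult
      differentiable_times_inverse differentiable_times_affine differentiable_times_const)

text \<open>
  The functions \<open>p(1/t) exp(-1/t)\<close>, extended by 0 to \<open>t \<le> 0\<close>.  Allowing a polynomial factor closes the
  class under differentiation, which is how its members are seen to be smooth, at \<open>t = 0\<close> as well.
\<close>
definition flat_exp :: "real poly \<Rightarrow> real \<Rightarrow> real" where
  "flat_exp p t = (if t > 0 then poly p (inverse t) * exp (- inverse t) else 0)"

lemma poly_exp_minus_tendsto_0: "((\<lambda>s. poly p s * exp (- s)) \<longlongrightarrow> (0::real)) at_top"
proof -
  have "((\<lambda>s. \<Sum>i\<le>degree p. coeff p i * (s ^ i / exp s)) \<longlongrightarrow> (\<Sum>i\<le>degree p. coeff p i * 0)) at_top"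
    by (intro tendsto_intros tendsto_power_div_exp_0)
  then show ?thesis
    by (simp add: poly_altdef sum_distrib_right exp_minus divide_inverse mult.assoc)
qed

lemma flat_exp_has_derivative:
  "(flat_exp p has_real_derivative flat_exp ([:0, 0, 1:] * (p - pderiv p)) t) (at t)"
proof (rule linorder_cases[of t 0])
  assume t: "t < 0"
  have "((\<lambda>t. 0) has_real_derivative 0) (at t)" by simp
  then have "(flat_exp p has_real_derivative 0) (at t)"
    by (rule has_field_derivative_transform_within_open[of _ _ _ "{..<0}"]) (use t in \<open>auto simp: flat_exp_def\<close>)
  then show ?thesis using t by (simp add: flat_exp_def)
next
  assume t: "t > 0"
  have "((\<lambda>t. poly p (inverse t) * exp (- inverse t)) has_real_derivative
     (poly (pderiv p) (inverse t) * (- (inverse t * inverse t))) * exp (- inverse t)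
     + exp (- inverse t) * (inverse t * inverse t) * poly p (inverse t)) (at t)"
    using t by (auto intro!: derivative_eq_intros DERIV_chain2[OF poly_DERIV] simp: field_simps power2_eq_square)
  moreover have "(poly (pderiv p) (inverse t) * (- (inverse t * inverse t))) * exp (- inverse t)
     + exp (- inverse t) * (inverse t * inverse t) * poly p (inverse t) = flat_exp ([:0, 0, 1:] * (p - pderiv p)) t"
    using t by (simp add: flat_exp_def algebra_simps)
  ultimately have "((\<lambda>t. poly p (inverse t) * exp (- inverse t)) has_real_derivative
      flat_exp ([:0, 0, 1:] * (p - pderiv p)) t) (at t)" by simp
  then show ?thesis
    by (rule has_field_derivative_transform_within_open[of _ _ _ "{0<..}"]) (use t in \<open>auto simp: flat_exp_def\<close>)
next
  assume t: "t = 0"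
  have "((\<lambda>h. flat_exp p h / h) \<longlongrightarrow> 0) (at 0)"
  proof (rule filterlim_split_at)
    have "\<forall>\<^sub>F h in at_left 0. flat_exp p h / h = 0"
      by (auto simp: eventually_at_filter flat_exp_def)
    then show "((\<lambda>h. flat_exp p h / h) \<longlongrightarrow> 0) (at_left 0)"
      by (rule tendsto_eventually)
    have "((\<lambda>h::real. poly (pCons 0 p) (inverse h) * exp (- inverse h)) \<longlongrightarrow> 0) (at_right 0)"
      by (rule filterlim_compose[OF poly_exp_minus_tendsto_0 filterlim_inverse_at_top_right])
    moreover have "\<forall>\<^sub>F h in at_right 0. poly (pCons 0 p) (inverse h) * exp (- inverse h) = flat_exp p h / h"
      by (auto simp: eventually_at_filter flat_exp_def divide_inverse)
    ultimately show "((\<lambda>h. flat_exp p h / h) \<longlongrightarrow> 0) (at_right 0)"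
      by (rule Lim_transform_eventually)
  qed
  then show ?thesis
    by (simp add: t has_field_derivative_iff flat_exp_def)
qed

lemma smooth_flat_exp: "smooth (flat_exp p)"
proof -
  have "differentiable_times k (flat_exp p)" for k
  proof (induction k arbitrary: p)
    case 0
    show ?case
      by (auto intro!: continuous_at_imp_continuous_on DERIV_isCont flat_exp_has_derivative)
  next
    case (Suc k)
    then show ?case using flat_exp_has_derivative by auto
  qed
  then show ?thesis by (simp add: smooth_def)
qed

text \<open>
  Rises from 0 to 1 within \<open>[-1/3, 1/3]\<close>.  The denominator never vanishes, since \<open>t + 1/3\<close> or \<open>1/3 - t\<close>
  is positive.
\<close>
definition smooth_step :: "real \<Rightarrow> real" where
  "smooth_step t = flat_exp 1 (t + 1/3) * inverse (flat_exp 1 (t + 1/3) + flat_exp 1 (1/3 - t))"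

lemma flat_exp_1_nonneg: "0 \<le> flat_exp 1 t" and flat_exp_1_pos: "0 < t \<Longrightarrow> 0 < flat_exp 1 t"
  and flat_exp_1_zero: "t \<le> 0 \<Longrightarrow> flat_exp 1 t = 0"
  by (auto simp: flat_exp_def)

lemma smooth_smooth_step: "smooth smooth_step"
proof -
  have 1: "smooth (\<lambda>t. flat_exp 1 (1 * t + 1/3))" "smooth (\<lambda>t. flat_exp 1 ((-1) * t + 1/3))"
    by (intro smooth_affine smooth_flat_exp)+
  have pos: "flat_exp 1 (1 * t + 1/3) + flat_exp 1 ((-1) * t + 1/3) \<noteq> 0" for t
    using flat_exp_1_nonneg[of "1 * t + 1/3"] flat_exp_1_nonneg[of "(-1) * t + 1/3"]
      flat_exp_1_pos[of "1 * t + 1/3"] flat_exp_1_pos[of "(-1) * t + 1/3"]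
    by (cases "t > 0") auto
  have "smooth (\<lambda>t. flat_exp 1 (1 * t + 1/3) *
      inverse (flat_exp 1 (1 * t + 1/3) + flat_exp 1 ((-1) * t + 1/3)))"
    by (intro smooth_mult smooth_inverse smooth_add 1 pos)
  then show ?thesis unfolding smooth_step_def[abs_def] by simp
qed

lemma smooth_step_0: "t \<le> - 1/3 \<Longrightarrow> smooth_step t = 0"
  and smooth_step_1: "1/3 \<le> t \<Longrightarrow> smooth_step t = 1"
  using flat_exp_1_pos[of "t + 1/3"] by (auto simp: smooth_step_def flat_exp_1_zero)

lemma smooth_step_bounds: "0 \<le> smooth_step t" "smooth_step t \<le> 1"
  using flat_exp_1_nonneg[of "t + 1/3"] flat_exp_1_nonneg[of "1/3 - t"]
  by (auto simp: smooth_step_def divide_inverse[symmetric] divide_le_eq)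

text \<open>
  The profile is the difference of the step at 0 and the step at 1.  The sum of its integer translates
  telescopes, and it equals 1 between the two transition intervals.
\<close>
lemma partition_profile:
  obtains \<eta> :: "real \<Rightarrow> real" where
    "smooth \<eta>"
    "\<And>t. \<bar>\<eta> t\<bar> \<le> 1"
    "\<And>t. 1/3 \<le> t \<Longrightarrow> t \<le> 2/3 \<Longrightarrow> \<eta> t = 1"
    "\<And>t. t \<le> - 1/3 \<or> 4/3 \<le> t \<Longrightarrow> \<eta> t = 0"
    "\<And>t. - 1/2 < t \<Longrightarrow> t < 3/2 \<Longrightarrow> \<eta> (t + 1) + \<eta> t + \<eta> (t - 1) = 1"
proof
  let ?\<eta> = "\<lambda>t. smooth_step t + (- 1) * smooth_step (1 * t + (- 1))"
  show "smooth ?\<eta>"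
    by (intro smooth_add smooth_mult smooth_const smooth_affine smooth_smooth_step)
  show "\<bar>?\<eta> t\<bar> \<le> 1" for t
    using smooth_step_bounds[of t] smooth_step_bounds[of "1 * t + (- 1)"] by (simp add: abs_le_iff)
  show "?\<eta> t = 1" if "1/3 \<le> t" "t \<le> 2/3" for t
    using that by (simp add: smooth_step_0 smooth_step_1)
  show "?\<eta> t = 0" if "t \<le> - 1/3 \<or> 4/3 \<le> t" for t
    using that by (auto simp: smooth_step_0 smooth_step_1)
  show "?\<eta> (t + 1) + ?\<eta> t + ?\<eta> (t - 1) = 1" if "- 1/2 < t" "t < 3/2" for t
    using that by (simp add: smooth_step_0 smooth_step_1)
qed


section \<open>Sums of tensor products are smooth\<close>

definition tensor_sum :: "'a set \<Rightarrow> ('a \<Rightarrow> complex) \<Rightarrow> ('a \<Rightarrow> 'd \<Rightarrow> real \<Rightarrow> real) \<Rightarrow> real ^ 'd::finite \<Rightarrow> complex" where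
  "tensor_sum A c g \<xi> = (\<Sum>x\<in>A. c x * complex_of_real (\<Prod>j\<in>UNIV. g x j (\<xi> $ j)))"

lemma tensor_has_derivative:
  fixes g :: "'d::finite \<Rightarrow> real \<Rightarrow> real"
  assumes "\<And>j t. (g j has_real_derivative g' j t) (at t)"
  shows "((\<lambda>\<xi>::real ^ 'd. \<Prod>j\<in>UNIV. g j (\<xi> $ j)) has_derivative
     (\<lambda>h. \<Sum>i\<in>UNIV. (g' i (\<xi> $ i) * h $ i) * (\<Prod>j\<in>UNIV - {i}. g j (\<xi> $ j)))) (at \<xi>)"
proof (rule has_derivative_prod)
  fix j :: 'd
  have "(g j has_derivative (\<lambda>h. g' j (\<xi> $ j) * h)) (at (\<xi> $ j))"
    using assms[of j "\<xi> $ j"] by (simp add: has_field_derivative_def)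
  moreover have "((\<lambda>\<xi>::real ^ 'd. \<xi> $ j) has_derivative (\<lambda>h. h $ j)) (at \<xi>)"
    by (intro bounded_linear_imp_has_derivative bounded_linear_vec_nth)
  ultimately show "((\<lambda>\<xi>::real ^ 'd. g j (\<xi> $ j)) has_derivative (\<lambda>h. g' j (\<xi> $ j) * h $ j)) (at \<xi>)"
    by (rule has_derivative_compose[rotated])
qed

text \<open>
  The class of these sums is closed under partial derivatives, which yields smoothness of every order by
  induction.
\<close>
lemma tensor_sum_partial_deriv:
  fixes g :: "'a \<Rightarrow> 'd::finite \<Rightarrow> real \<Rightarrow> real"
  assumes "\<And>x j t. (g x j has_real_derivative g' x j t) (at t)"
  shows "tensor_sum A c g differentiable (at \<xi>)"
    and "partial_deriv i (tensor_sum A c g) = tensor_sum A c (\<lambda>x j. if j = i then g' x j else g x j)"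
proof -
  let ?D = "\<lambda>\<xi> h. \<Sum>x\<in>A. c x * complex_of_real
     (\<Sum>i\<in>UNIV. (g' x i (\<xi> $ i) * h $ i) * (\<Prod>j\<in>UNIV - {i}. g x j (\<xi> $ j)))"
  have D: "(tensor_sum A c g has_derivative ?D \<xi>) (at \<xi>)" for \<xi>
    unfolding tensor_sum_def[abs_def]
    by (intro has_derivative_sum has_derivative_mult_right has_derivative_of_real tensor_has_derivative assms)
  then show "tensor_sum A c g differentiable (at \<xi>)" by (auto simp: differentiable_def)
  show "partial_deriv i (tensor_sum A c g) = tensor_sum A c (\<lambda>x j. if j = i then g' x j else g x j)"
  proof
    fix \<xi> :: "real ^ 'd"
    have "(\<Sum>k\<in>UNIV. (g' x k (\<xi> $ k) * axis i 1 $ k) * (\<Prod>j\<in>UNIV - {k}. g x j (\<xi> $ j)))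
        = (\<Prod>j\<in>UNIV. (if j = i then g' x j else g x j) (\<xi> $ j))" for x
    proof -
      have "(\<Sum>k\<in>UNIV. (g' x k (\<xi> $ k) * axis i 1 $ k) * (\<Prod>j\<in>UNIV - {k}. g x j (\<xi> $ j)))
         = (\<Sum>k\<in>{i}. (g' x k (\<xi> $ k) * axis i 1 $ k) * (\<Prod>j\<in>UNIV - {k}. g x j (\<xi> $ j)))"
        by (rule sum.mono_neutral_right) (auto simp: axis_def)
      also have "\<dots> = g' x i (\<xi> $ i) * (\<Prod>j\<in>UNIV - {i}. g x j (\<xi> $ j))" by simp
      also have "\<dots> = (\<Prod>j\<in>UNIV. (if j = i then g' x j else g x j) (\<xi> $ j))"
        by (subst (2) prod.remove[of _ i]) (auto intro: prod.cong)
      finally show ?thesis .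
    qed
    then have "?D \<xi> (axis i 1) = tensor_sum A c (\<lambda>x j. if j = i then g' x j else g x j) \<xi>"
      by (simp add: tensor_sum_def)
    then show "partial_deriv i (tensor_sum A c g) \<xi> = tensor_sum A c (\<lambda>x j. if j = i then g' x j else g x j) \<xi>"
      by (simp only: partial_deriv_def frechet_derivative_at[OF D[of \<xi>], symmetric])
  qed
qed

lemma tensor_sum_Ck:
  assumes "\<And>x j. smooth (g x j)"
  shows "Ck k (tensor_sum A c g)"
  using assms
proof (induction k arbitrary: g)
  case 0
  have "tensor_sum A c g differentiable (at \<xi>)" for \<xi>
    by (rule tensor_sum_partial_deriv(1)) (use 0 in \<open>auto intro: smooth_has_deriv\<close>)
  then show ?case by (auto intro!: continuous_at_imp_continuous_on differentiable_imp_continuous_within)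
next
  case (Suc k)
  have d: "(g x j has_real_derivative deriv (g x j) t) (at t)" for x j t
    using Suc.prems by (rule smooth_has_deriv)
  have "Ck k (tensor_sum A c (\<lambda>x j. if j = i then deriv (g x j) else g x j))" for i
    by (rule Suc.IH) (use Suc.prems in \<open>auto intro: smooth_has_deriv\<close>)
  then show ?case
    using tensor_sum_partial_deriv[where g' = "\<lambda>x j. deriv (g x j)", OF d] by auto
qed

section \<open>Interpolation of lattice functions\<close>

lemma test_function_H1_gradient:
  assumes "test_function f"
  shows "H1_gradient f (gradient f)"
proof -
  have Ck: "Ck k f" for k using assms by (simp add: test_function_def)
  have meas: "h \<in> borel_measurable lebesgue" if "continuous_on UNIV h" for h :: "real ^ 'a \<Rightarrow> 'b::topological_space"
    using borel_measurable_continuous_onI[OF that] by (simp add: measurable_completion)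
  have "continuous_on UNIV f" using Ck[of 0] by simp
  moreover have "continuous_on UNIV (gradient f)"
    using Ck[of 1] unfolding gradient_def by (intro continuous_on_vec_lambda) simp
  ultimately show ?thesis
    unfolding H1_gradient_def using assms by (auto intro!: meas exI[of _ "\<lambda>_. f"])
qed

abbreviation real_vec :: "int ^ 'd::finite \<Rightarrow> real ^ 'd" where
  "real_vec x \<equiv> (\<chi> j. of_int (x $ j))"

lemma emeasure_shifted_cube:
  fixes a :: "real ^ 'd::finite"
  assumes "s \<le> t"
  shows "emeasure lebesgue (cbox (\<chi> j. a $ j + s) (\<chi> j. a $ j + t)) = ennreal ((t - s) ^ CARD('d))"
proof -
  let ?c = "cbox (\<chi> j. a $ j + s) (\<chi> j. a $ j + t)"
  have "a + (\<chi> j. s) \<in> ?c" using assms by (simp add: mem_box_cart)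
  then have "measure lborel ?c = (t - s) ^ CARD('d)"
    by (subst content_cbox_cart) (auto simp: algebra_simps)
  moreover have "emeasure lebesgue ?c = ennreal (measure lborel ?c)"
    using emeasure_lborel_cbox_finite[of "\<chi> j. a $ j + s" "\<chi> j. a $ j + t"]
    by (simp add: emeasure_eq_ennreal_measure)
  ultimately show ?thesis by simp
qed

lemma nn_integral_sum_cboxes:
  fixes a b :: "'a \<Rightarrow> 'b::euclidean_space"
  shows "(\<integral>\<^sup>+\<xi>. (\<Sum>x\<in>B. ennreal (f x) * indicator (cbox (a x) (b x)) \<xi>) \<partial>lebesgue)
     = (\<Sum>x\<in>B. ennreal (f x) * emeasure lebesgue (cbox (a x) (b x)))"
proof -
  have "(\<lambda>\<xi>. ennreal (f x) * indicator (cbox (a x) (b x)) \<xi>) \<in> borel_measurable lebesgue" for x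
    by (intro borel_measurable_times_ennreal borel_measurable_const borel_measurable_indicator) simp
  then show ?thesis by (simp add: nn_integral_sum nn_integral_cmult_indicator)
qed

definition unit_shifts :: "(int ^ 'd::finite) set" where
  "unit_shifts = lattice_box {-1, 0, 1}"

text \<open>
  The reason why the gradient of the interpolant is controlled by differences of \<open>u\<close>: at a point \<open>\<xi>\<close>
  of the cell of \<open>x0\<close> only the lattice points adjacent to \<open>x0\<close> contribute, and since the factors in the
  \<open>i\<close>-th coordinate cancel when summed over translates, \<open>u x0\<close> may be subtracted from every
  coefficient.  It is applied with \<open>g i = \<eta>'\<close> and \<open>g j = \<eta>\<close> for \<open>j \<noteq> i\<close>.
\<close>
lemma tensor_combination_le_differences:
  fixes u :: "int ^ 'd::finite \<Rightarrow> complex" and g :: "'d \<Rightarrow> real \<Rightarrow> real"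
  assumes A: "finite A" "\<And>x. u x \<noteq> 0 \<Longrightarrow> x \<in> A"
    and supp: "\<And>j t. t \<le> - 1 \<or> 2 \<le> t \<Longrightarrow> g j t = 0"
    and M: "\<And>j t. \<bar>g j t\<bar> \<le> M"
    and cancel: "\<And>t. 0 \<le> t \<Longrightarrow> t < 1 \<Longrightarrow> g i (t + 1) + g i t + g i (t - 1) = 0"
    and x0: "x0 = (\<chi> j. \<lfloor>\<xi> $ j\<rfloor>)"
  shows "cmod (tensor_sum A u (\<lambda>x j t. g j (t - of_int (x $ j))) \<xi>)
     \<le> M ^ CARD('d) * (\<Sum>e\<in>unit_shifts. cmod (u (x0 + e) - u x0))"
proof -
  define P where "P e = (\<Prod>j\<in>UNIV. g j (\<xi> $ j - of_int (x0 $ j) - of_int (e $ j)))" for e :: "int ^ 'd"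
  have frac: "0 \<le> \<xi> $ j - of_int (x0 $ j)" "\<xi> $ j - of_int (x0 $ j) < 1" for j
    unfolding x0 by (auto simp: of_int_floor_le) linarith
  have far: "P e = 0" if outside: "e \<notin> unit_shifts" for e
  proof -
    obtain j where j: "e $ j \<notin> {-1, 0, 1}" using outside unfolding unit_shifts_def lattice_box_def by blast
    then have "e $ j \<le> - 2 \<or> e $ j \<ge> 2" by (simp, presburger)
    then have "real_of_int (e $ j) \<le> - 2 \<or> real_of_int (e $ j) \<ge> 2" by linarith
    then have "g j (\<xi> $ j - of_int (x0 $ j) - of_int (e $ j)) = 0"
      using frac[of j] by (intro supp) linarith
    then show ?thesis unfolding P_def by (intro prod_zero) auto
  qed
  have fin: "finite (unit_shifts :: (int ^ 'd) set)" by (simp add: unit_shifts_def finite_lattice_box)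
  have "tensor_sum A u (\<lambda>x j t. g j (t - of_int (x $ j))) \<xi> = (\<Sum>x\<in>A. u x * complex_of_real (P (x - x0)))"
    by (simp add: tensor_sum_def P_def algebra_simps)
  also have "\<dots> = (\<Sum>x\<in>A \<union> (\<lambda>e. x0 + e) ` unit_shifts. u x * complex_of_real (P (x - x0)))"
    by (rule sum.mono_neutral_left) (use A fin in auto)
  also have "\<dots> = (\<Sum>x\<in>(\<lambda>e. x0 + e) ` unit_shifts. u x * complex_of_real (P (x - x0)))"
  proof (rule sum.mono_neutral_right)
    show "\<forall>x\<in>A \<union> (\<lambda>e. x0 + e) ` unit_shifts - (\<lambda>e. x0 + e) ` unit_shifts. u x * complex_of_real (P (x - x0)) = 0"
    proof
      fix x assume "x \<in> A \<union> (\<lambda>e. x0 + e) ` unit_shifts - (\<lambda>e. x0 + e) ` unit_shifts"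
      then have "x - x0 \<notin> unit_shifts"
        by (metis DiffD2 add.commute diff_add_cancel image_eqI)
      then show "u x * complex_of_real (P (x - x0)) = 0" by (simp add: far)
    qed
  qed (use A fin in auto)
  also have "\<dots> = (\<Sum>e\<in>unit_shifts. u (x0 + e) * complex_of_real (P e))"
    by (subst sum.reindex) (auto simp: inj_on_def)
  finally have 1: "tensor_sum A u (\<lambda>x j t. g j (t - of_int (x $ j))) \<xi>
     = (\<Sum>e\<in>unit_shifts. u (x0 + e) * complex_of_real (P e))" .
  have "(\<Sum>e\<in>unit_shifts. P e) = (\<Prod>j\<in>UNIV. \<Sum>k\<in>{-1, 0, 1}. g j (\<xi> $ j - of_int (x0 $ j) - of_int k))"
    unfolding P_def unit_shifts_def by (rule sum_lattice_box_prod) simp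
  also have "\<dots> = 0"
    using cancel[OF frac[of i]] by (intro prod_zero bexI[of _ i]) (auto simp: algebra_simps)
  finally have "(\<Sum>e\<in>unit_shifts. u x0 * complex_of_real (P e)) = 0"
    by (simp flip: sum_distrib_left of_real_sum)
  with 1 have "tensor_sum A u (\<lambda>x j t. g j (t - of_int (x $ j))) \<xi>
     = (\<Sum>e\<in>unit_shifts. (u (x0 + e) - u x0) * complex_of_real (P e))"
    by (simp add: left_diff_distrib sum_subtractf)
  also have "cmod \<dots> \<le> (\<Sum>e\<in>unit_shifts. cmod (u (x0 + e) - u x0) * M ^ CARD('d))"
  proof (rule sum_norm_le)
    fix e :: "int ^ 'd"
    have "\<bar>P e\<bar> \<le> (\<Prod>j\<in>(UNIV :: 'd set). M)"
      unfolding P_def abs_prod by (rule prod_mono) (use M in auto)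
    then have "\<bar>P e\<bar> \<le> M ^ CARD('d)" by simp
    then show "cmod ((u (x0 + e) - u x0) * complex_of_real (P e)) \<le> cmod (u (x0 + e) - u x0) * M ^ CARD('d)"
      by (simp add: norm_mult mult_left_mono)
  qed
  finally show ?thesis by (simp add: sum_distrib_left mult.commute)
qed

text \<open>
  The interpolant is \<open>U(\<xi>) = \<Sum> u(x) \<Prod> \<eta>(\<xi>\<^sub>j - x\<^sub>j)\<close>.  In the constant \<open>K\<close>, the \<open>d\<close> partial derivatives
  contribute a factor \<open>d\<close>, the bound \<open>M\<close> for \<open>\<eta>\<close> and its derivative contributes \<open>M^(2 d)\<close>, the
  Cauchy-Schwarz inequality over the \<open>3^d\<close> unit shifts and their number contribute \<open>3^d\<close> each, and
  translating by a unit shift contributes \<open>d\<^sup>2\<close>.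
\<close>
lemma smooth_interpolation:
  obtains K :: real where "K > 0"
    and "\<And>(u :: int ^ 'd::finite \<Rightarrow> complex) E. finite {x. u x \<noteq> 0} \<Longrightarrow> 0 \<le> E \<Longrightarrow> Q0 u \<le> ennreal E \<Longrightarrow>
      \<exists>U. test_function U \<and>
        (\<forall>x \<xi>. \<xi> \<in> cbox (\<chi> j. real_vec x $ j + 1/3) (\<chi> j. real_vec x $ j + 2/3) \<longrightarrow> U \<xi> = u x) \<and>
        (\<integral>\<^sup>+\<xi>. ennreal ((norm (gradient U \<xi>))\<^sup>2) \<partial>lebesgue) \<le> ennreal (K * E)"
proof -
  obtain \<eta> :: "real \<Rightarrow> real" where \<eta>: "smooth \<eta>"
    and \<eta>_le: "\<And>t. \<bar>\<eta> t\<bar> \<le> 1"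
    and \<eta>_1: "\<And>t. 1/3 \<le> t \<Longrightarrow> t \<le> 2/3 \<Longrightarrow> \<eta> t = 1"
    and \<eta>_0: "\<And>t. t \<le> - 1/3 \<or> 4/3 \<le> t \<Longrightarrow> \<eta> t = 0"
    and \<eta>_sum: "\<And>t. - 1/2 < t \<Longrightarrow> t < 3/2 \<Longrightarrow> \<eta> (t + 1) + \<eta> t + \<eta> (t - 1) = 1"
    using partition_profile by metis
  note d\<eta> = smooth_has_deriv(1)[OF \<eta>]
  have d\<eta>_0: "deriv \<eta> t = 0" if "t \<le> - 1 \<or> 2 \<le> t" for t
  proof -
    have "(\<eta> has_real_derivative 0) (at t)"
      by (rule has_field_derivative_transform_within_open[of "\<lambda>_. 0" _ _ "{..< - 1/3} \<union> {4/3 <..}"])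
        (use that in \<open>auto simp: \<eta>_0\<close>)
    then show ?thesis by (rule DERIV_imp_deriv)
  qed
  have d\<eta>_sum: "deriv \<eta> (t + 1) + deriv \<eta> t + deriv \<eta> (t - 1) = 0" if "0 \<le> t" "t < 1" for t
  proof -
    have "((\<lambda>t. \<eta> (t + 1) + \<eta> t + \<eta> (t - 1)) has_real_derivative
        deriv \<eta> (t + 1) * 1 + deriv \<eta> t + deriv \<eta> (t - 1) * 1) (at t)"
      by (intro DERIV_add DERIV_chain2[OF d\<eta>] d\<eta>) (auto intro!: derivative_eq_intros)
    moreover have "((\<lambda>t. \<eta> (t + 1) + \<eta> t + \<eta> (t - 1)) has_real_derivative 0) (at t)"
      by (rule has_field_derivative_transform_within_open[of "\<lambda>_. 1" _ _ "{- 1/2 <..< 3/2}"])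
        (use that in \<open>auto simp: \<eta>_sum\<close>)
    ultimately show ?thesis using DERIV_unique by fastforce
  qed
  obtain M where M: "1 \<le> M" "\<And>t. \<bar>deriv \<eta> t\<bar> \<le> M"
  proof -
    have "bounded (deriv \<eta> ` {-1..2})"
      by (intro compact_imp_bounded compact_continuous_image smooth_continuous_on smooth_has_deriv \<eta>) auto
    then obtain b where b: "\<And>t. t \<in> {-1..2} \<Longrightarrow> \<bar>deriv \<eta> t\<bar> \<le> b"
      unfolding bounded_iff by (metis imageI real_norm_def)
    have "\<bar>deriv \<eta> t\<bar> \<le> max 1 b" for t
      using b[of t] d\<eta>_0[of t] by (cases "t \<in> {-1..2}") (auto simp: le_max_iff_disj)
    with that[of "max 1 b"] show thesis by auto
  qed
  let ?d = "real CARD('d)"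
  define c where "c = ?d * (M ^ CARD('d))\<^sup>2 * 3 ^ CARD('d)"
  define K where "K = c * 3 ^ CARD('d) * ?d\<^sup>2"
  have "K > 0" using M by (simp add: K_def c_def)
  moreover have "\<exists>U. test_function U \<and>
        (\<forall>x \<xi>. \<xi> \<in> cbox (\<chi> j. real_vec x $ j + 1/3) (\<chi> j. real_vec x $ j + 2/3) \<longrightarrow> U \<xi> = u x) \<and>
        (\<integral>\<^sup>+\<xi>. ennreal ((norm (gradient U \<xi>))\<^sup>2) \<partial>lebesgue) \<le> ennreal (K * E)"
    if fin: "finite {x. u x \<noteq> 0}" and E: "0 \<le> E" "Q0 u \<le> ennreal E" for u :: "int ^ 'd \<Rightarrow> complex" and E
  proof -
    define A where "A = {x. u x \<noteq> 0}"
    have A: "finite A" "\<And>x. u x \<noteq> 0 \<Longrightarrow> x \<in> A" using fin by (auto simp: A_def)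
    define g where "g x j t = \<eta> (t - of_int (x $ j))" for x :: "int ^ 'd" and j t
    define U where "U = tensor_sum A u g"
    have g: "smooth (g x j)" for x j
      using smooth_affine[OF \<eta>, of 1 "- of_int (x $ j)"] by (simp add: g_def[abs_def])
    have dg: "(g x j has_real_derivative deriv \<eta> (t - of_int (x $ j))) (at t)" for x j t
    proof -
      have "((\<lambda>t. t - of_int (x $ j)) has_real_derivative 1) (at t)"
        by (auto intro!: derivative_eq_intros)
      then show ?thesis
        unfolding g_def[abs_def] using DERIV_chain2[OF d\<eta>] by fastforce
    qed
    have "bounded {\<xi>. U \<xi> \<noteq> 0}"
    proof (rule bounded_subset)
      show "bounded (\<Union>x\<in>A. cbox (\<chi> j. real_vec x $ j + (-1)) (\<chi> j. real_vec x $ j + 2))"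
        using A by auto
      show "{\<xi>. U \<xi> \<noteq> 0} \<subseteq> (\<Union>x\<in>A. cbox (\<chi> j. real_vec x $ j + (-1)) (\<chi> j. real_vec x $ j + 2))"
      proof
        fix \<xi> assume "\<xi> \<in> {\<xi>. U \<xi> \<noteq> 0}"
        then obtain x where x: "x \<in> A" "u x * complex_of_real (\<Prod>j\<in>UNIV. g x j (\<xi> $ j)) \<noteq> 0"
          by (auto simp: U_def tensor_sum_def elim: sum.not_neutral_contains_not_neutral)
        then have "\<eta> (\<xi> $ j - of_int (x $ j)) \<noteq> 0" for j by (auto simp: g_def)
        then have near: "\<not> (\<xi> $ j - of_int (x $ j) \<le> - 1/3 \<or> 4/3 \<le> \<xi> $ j - of_int (x $ j))" for j
          using \<eta>_0 by blast
        have "of_int (x $ j) + (- 1) \<le> \<xi> $ j \<and> \<xi> $ j \<le> of_int (x $ j) + 2" for j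
          using near[of j] by linarith
        then have "\<xi> \<in> cbox (\<chi> j. real_vec x $ j + (-1)) (\<chi> j. real_vec x $ j + 2)"
          by (simp add: mem_box_cart)
        with x show "\<xi> \<in> (\<Union>x\<in>A. cbox (\<chi> j. real_vec x $ j + (-1)) (\<chi> j. real_vec x $ j + 2))" by blast
      qed
    qed
    then have test: "test_function U"
      unfolding test_function_def U_def by (simp add: compact_closure tensor_sum_Ck g)
    have center: "U \<xi> = u x"
      if "\<xi> \<in> cbox (\<chi> j. real_vec x $ j + 1/3) (\<chi> j. real_vec x $ j + 2/3)" for x \<xi>
    proof -
      have "of_int (x $ j) + 1/3 \<le> \<xi> $ j \<and> \<xi> $ j \<le> of_int (x $ j) + 2/3" for j
        using that by (simp add: mem_box_cart)
      then have \<xi>: "1/3 \<le> \<xi> $ j - of_int (x $ j)" "\<xi> $ j - of_int (x $ j) \<le> 2/3" for j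
        by (metis add.commute le_diff_eq, metis add.commute diff_le_eq)
      have same: "(\<Prod>j\<in>UNIV. g x j (\<xi> $ j)) = 1"
        using \<xi> by (auto simp: g_def \<eta>_1 intro!: prod.neutral)
      have other: "(\<Prod>j\<in>UNIV. g y j (\<xi> $ j)) = 0" if distinct: "y \<noteq> x" for y
      proof -
        obtain j where "y $ j \<noteq> x $ j" using distinct by (auto simp: vec_eq_iff)
        then have "y $ j \<le> x $ j - 1 \<or> x $ j + 1 \<le> y $ j" by auto
        then have "real_of_int (y $ j) \<le> of_int (x $ j) - 1 \<or> of_int (x $ j) + 1 \<le> real_of_int (y $ j)"
          by linarith
        then have "g y j (\<xi> $ j) = 0"
          unfolding g_def using \<xi>[of j] by (intro \<eta>_0) linarith
        then show ?thesis by (intro prod_zero) auto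
      qed
      have "U \<xi> = (\<Sum>y\<in>A. if y = x then u y else 0)"
        unfolding U_def tensor_sum_def by (rule sum.cong) (auto simp: same other simp del: of_real_prod)
      then show ?thesis using A by (auto simp: sum.delta)
    qed
    \<comment> \<open>Evaluated at the base point of a cell, \<open>F\<close> dominates the squared gradient on that cell.\<close>
    define F where "F x = c * (\<Sum>e\<in>unit_shifts. (cmod (u (x + e) - u x))\<^sup>2)" for x
    have c: "0 \<le> c" using M by (simp add: c_def)
    have F_nonneg: "0 \<le> F x" for x using c by (simp add: F_def sum_nonneg)
    have card: "card (unit_shifts :: (int ^ 'd) set) = 3 ^ CARD('d)"
      by (simp add: unit_shifts_def card_lattice_box numeral_3_eq_3)
    have fin_shifts: "finite (unit_shifts :: (int ^ 'd) set)" by (simp add: unit_shifts_def finite_lattice_box)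
    have grad: "(norm (gradient U \<xi>))\<^sup>2 \<le> F (\<chi> j. \<lfloor>\<xi> $ j\<rfloor>)" for \<xi>
    proof -
      define x0 where "x0 = (\<chi> j. \<lfloor>\<xi> $ j\<rfloor>)"
      let ?S = "\<Sum>e\<in>unit_shifts. cmod (u (x0 + e) - u x0)"
      have "cmod (partial_deriv i U \<xi>) \<le> M ^ CARD('d) * ?S" for i
      proof -
        have "partial_deriv i U = tensor_sum A u (\<lambda>x j. if j = i then (\<lambda>t. deriv \<eta> (t - of_int (x $ j))) else g x j)"
          unfolding U_def by (rule tensor_sum_partial_deriv(2)) (rule dg)
        also have "\<dots> = tensor_sum A u (\<lambda>x j t. (if j = i then deriv \<eta> else \<eta>) (t - of_int (x $ j)))"
          by (rule arg_cong[of _ _ "tensor_sum A u"]) (auto simp: fun_eq_iff g_def)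
        finally have eq: "partial_deriv i U \<xi> = tensor_sum A u (\<lambda>x j t. (if j = i then deriv \<eta> else \<eta>) (t - of_int (x $ j))) \<xi>"
          by simp
        show ?thesis unfolding eq
        proof (rule tensor_combination_le_differences[where i = i])
          show "(if j = i then deriv \<eta> else \<eta>) t = 0" if "t \<le> - 1 \<or> 2 \<le> t" for j t
            using that d\<eta>_0[of t] \<eta>_0[of t] by auto
          show "\<bar>(if j = i then deriv \<eta> else \<eta>) t\<bar> \<le> M" for j t
            using M \<eta>_le[of t] by (auto intro: order_trans)
        qed (use A d\<eta>_sum in \<open>auto simp: x0_def\<close>)
      qed
      then have "(cmod (partial_deriv i U \<xi>))\<^sup>2 \<le> (M ^ CARD('d) * ?S)\<^sup>2" for i
        by (rule power_mono) simp
      then have "(\<Sum>i\<in>(UNIV :: 'd set). (cmod (partial_deriv i U \<xi>))\<^sup>2) \<le> (\<Sum>i\<in>(UNIV :: 'd set). (M ^ CARD('d) * ?S)\<^sup>2)"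
        by (intro sum_mono)
      moreover have "(norm (gradient U \<xi>))\<^sup>2 = (\<Sum>i\<in>UNIV. (cmod (partial_deriv i U \<xi>))\<^sup>2)"
        by (simp add: norm_vec_def L2_set_def gradient_def sum_nonneg)
      moreover have "(\<Sum>i\<in>(UNIV :: 'd set). (M ^ CARD('d) * ?S)\<^sup>2) = ?d * (M ^ CARD('d))\<^sup>2 * ?S\<^sup>2"
        by (simp add: power_mult_distrib)
      moreover have "?S\<^sup>2 \<le> real (card (unit_shifts :: (int ^ 'd) set)) * (\<Sum>e\<in>unit_shifts. (cmod (u (x0 + e) - u x0))\<^sup>2)"
        using sum_squared_le_sum_of_squares[of "\<lambda>e. cmod (u (x0 + e) - u x0)" unit_shifts]
          by (simp add: card mult.commute)
      then have "?d * (M ^ CARD('d))\<^sup>2 * ?S\<^sup>2 \<le> ?d * (M ^ CARD('d))\<^sup>2 * (3 ^ CARD('d) * (\<Sum>e\<in>unit_shifts. (cmod (u (x0 + e) - u x0))\<^sup>2))"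
        by (intro mult_left_mono) (auto simp: card)
      ultimately have "(norm (gradient U \<xi>))\<^sup>2 \<le> ?d * (M ^ CARD('d))\<^sup>2 * (3 ^ CARD('d) * (\<Sum>e\<in>unit_shifts. (cmod (u (x0 + e) - u x0))\<^sup>2))"
        by linarith
      then show ?thesis by (simp add: F_def c_def x0_def mult.assoc)
    qed
    \<comment> \<open>The gradient vanishes outside the cells based at points of \<open>B\<close>, which makes the integral a finite sum.\<close>
    define B where "B = A \<union> (\<Union>e\<in>unit_shifts. (\<lambda>y. y - e) ` A)"
    have B: "finite B" using A fin_shifts by (auto simp: B_def)
    have F_supp: "F x = 0" if "x \<notin> B" for x
    proof -
      have "u x = 0" using that A by (auto simp: B_def)
      moreover have "u (x + e) = 0" if "e \<in> unit_shifts" for e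
      proof (rule ccontr)
        assume "u (x + e) \<noteq> 0"
        then have "x + e - e \<in> (\<lambda>y. y - e) ` A" using A by blast
        with \<open>x \<notin> B\<close> \<open>e \<in> unit_shifts\<close> show False by (auto simp: B_def)
      qed
      ultimately show ?thesis by (simp add: F_def)
    qed
    let ?Q = "\<lambda>x. cbox (\<chi> j. real_vec x $ j + 0) (\<chi> j. real_vec x $ j + 1)"
    have "(\<integral>\<^sup>+\<xi>. ennreal ((norm (gradient U \<xi>))\<^sup>2) \<partial>lebesgue)
       \<le> (\<integral>\<^sup>+\<xi>. (\<Sum>x\<in>B. ennreal (F x) * indicator (?Q x) \<xi>) \<partial>lebesgue)"
    proof (rule nn_integral_mono)
      fix \<xi> :: "real ^ 'd"
      define x0 where "x0 = (\<chi> j. \<lfloor>\<xi> $ j\<rfloor>)"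
      have "\<xi> \<in> ?Q x0" by (simp add: mem_box_cart x0_def)
      have "ennreal ((norm (gradient U \<xi>))\<^sup>2) \<le> ennreal (F x0)"
        using grad[of \<xi>] by (simp add: x0_def ennreal_leI)
      also have "\<dots> \<le> (\<Sum>x\<in>B. ennreal (F x) * indicator (?Q x) \<xi>)"
      proof (cases "x0 \<in> B")
        case True
        have "ennreal (F x0) * indicator (?Q x0) \<xi> \<le> (\<Sum>x\<in>B. ennreal (F x) * indicator (?Q x) \<xi>)"
          by (rule member_le_sum) (use True B in auto)
        then show ?thesis using \<open>\<xi> \<in> ?Q x0\<close> by simp
      qed (simp add: F_supp)
      finally show "ennreal ((norm (gradient U \<xi>))\<^sup>2) \<le> (\<Sum>x\<in>B. ennreal (F x) * indicator (?Q x) \<xi>)" .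
    qed
    also have "\<dots> = (\<Sum>x\<in>B. ennreal (F x) * emeasure lebesgue (?Q x))"
      by (rule nn_integral_sum_cboxes)
    also have "\<dots> = (\<Sum>x\<in>B. ennreal (F x))"
      by (subst emeasure_shifted_cube) auto
    also have "\<dots> = ennreal (\<Sum>x\<in>B. F x)"
      by (simp add: F_nonneg)
    also have "\<dots> \<le> ennreal (K * E)"
    proof (rule ennreal_leI)
      have "(\<Sum>x\<in>B. F x) = c * (\<Sum>e\<in>unit_shifts. \<Sum>x\<in>B. (cmod (u (x + e) - u x))\<^sup>2)"
        unfolding F_def sum_distrib_left[symmetric] by (subst sum.swap) simp
      also have "\<dots> \<le> c * (\<Sum>e\<in>(unit_shifts :: (int ^ 'd) set). (?d * real 1)\<^sup>2 * E)"
      proof (intro mult_left_mono sum_mono sum_shift_energy_le c E B)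
        fix e :: "int ^ 'd" and j assume "e \<in> unit_shifts"
        then have "e $ j \<in> {-1, 0, 1}" by (simp only: unit_shifts_def lattice_box_def mem_Collect_eq)
        then show "\<bar>e $ j\<bar> \<le> int 1" by auto
      qed
      also have "\<dots> = K * E" by (simp add: card K_def)
      finally show "(\<Sum>x\<in>B. F x) \<le> K * E" .
    qed
    finally show ?thesis using test center by blast
  qed
  ultimately show thesis using that by blast
qed

text \<open>
  The interpolant is inserted into the Euclidean inequality.  The middle cubes have volume \<open>3^(-d)\<close> and
  carry enough of the left-hand side.
\<close>
lemma hardy_lattice_of_euclidean:
  obtains C :: real where "\<And>W :: int ^ 'd::finite \<Rightarrow> real. (\<And>x. 0 \<le> W x) \<Longrightarrow>
      hardy_weight_euclidean (cell_extension W) \<Longrightarrow>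
      hardy_weight_lattice W \<and>
      hardy_const_lattice W \<le> C * hardy_const_euclidean (cell_extension W)"
proof -
  obtain K :: real where K: "K > 0"
    and interp: "\<And>(u :: int ^ 'd \<Rightarrow> complex) E. finite {x. u x \<noteq> 0} \<Longrightarrow> 0 \<le> E \<Longrightarrow> Q0 u \<le> ennreal E \<Longrightarrow>
      \<exists>U. test_function U \<and>
        (\<forall>x \<xi>. \<xi> \<in> cbox (\<chi> j. real_vec x $ j + 1/3) (\<chi> j. real_vec x $ j + 2/3) \<longrightarrow> U \<xi> = u x) \<and>
        (\<integral>\<^sup>+\<xi>. ennreal ((norm (gradient U \<xi>))\<^sup>2) \<partial>lebesgue) \<le> ennreal (K * E)"
    using smooth_interpolation[where 'd = 'd] by metis
  define C where "C = 2 * (3 ^ CARD('d) * K)"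
  have C: "C > 0" using K by (simp add: C_def)
  have "hardy_weight_lattice W \<and> hardy_const_lattice W \<le> C * hardy_const_euclidean (cell_extension W)"
    if W: "\<And>x. 0 \<le> W x" and JW: "hardy_weight_euclidean (cell_extension W)" for W :: "int ^ 'd \<Rightarrow> real"
  proof -
    have *: "hardy_weight_lattice W \<and> hardy_const_lattice W \<le> C * H"
      if H: "H \<in> hardy_bounds_euclidean (cell_extension W)" for H
    proof -
      have H0: "0 \<le> H" using H by (simp add: hardy_bounds_euclidean_def)
      have bound: "(\<Sum>x\<in>F. W x * (cmod (u x))\<^sup>2) \<le> (3 ^ CARD('d) * K * H) * E"
        if u: "finite {x. u x \<noteq> 0}" "Q0 u = ennreal E" "0 \<le> E" "finite F" for u E F
      proof -
        let ?q = "\<lambda>x::int ^ 'd. cbox (\<chi> j. real_vec x $ j + 1/3) (\<chi> j. real_vec x $ j + 2/3)"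
        obtain U where U: "test_function U"
          and val: "\<And>x \<xi>. \<xi> \<in> ?q x \<Longrightarrow> U \<xi> = u x"
          and grad: "(\<integral>\<^sup>+\<xi>. ennreal ((norm (gradient U \<xi>))\<^sup>2) \<partial>lebesgue) \<le> ennreal (K * E)"
          using interp[OF u(1,3)] u(2) by auto
        let ?w = "\<lambda>x. W x * (cmod (u x))\<^sup>2"
        have floor: "(\<chi> j. \<lfloor>\<xi> $ j\<rfloor>) = x" if "\<xi> \<in> ?q x" for x \<xi>
        proof -
          have "of_int (x $ j) \<le> \<xi> $ j" "\<xi> $ j < of_int (x $ j) + 1" for j
          proof -
            have "of_int (x $ j) + 1/3 \<le> \<xi> $ j" "\<xi> $ j \<le> of_int (x $ j) + 2/3"
              using that by (auto simp: mem_box_cart)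
            then show "of_int (x $ j) \<le> \<xi> $ j" "\<xi> $ j < of_int (x $ j) + 1" by linarith+
          qed
          then show ?thesis by (simp add: vec_eq_iff floor_unique)
        qed
        have "ennreal ((\<Sum>x\<in>F. ?w x) * (1/3) ^ CARD('d)) = (\<Sum>x\<in>F. ennreal (?w x) * ennreal ((2/3 - 1/3) ^ CARD('d)))"
          using W by (simp add: sum_distrib_right ennreal_mult[symmetric])
        also have "\<dots> = (\<Sum>x\<in>F. ennreal (?w x) * emeasure lebesgue (?q x))"
          by (subst emeasure_shifted_cube) auto
        also have "\<dots> = (\<integral>\<^sup>+\<xi>. (\<Sum>x\<in>F. ennreal (?w x) * indicator (?q x) \<xi>) \<partial>lebesgue)"
          by (rule nn_integral_sum_cboxes[symmetric])
        also have "\<dots> \<le> (\<integral>\<^sup>+\<xi>. ennreal (cell_extension W \<xi> * (cmod (U \<xi>))\<^sup>2) \<partial>lebesgue)"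
        proof (rule nn_integral_mono)
          fix \<xi> :: "real ^ 'd"
          define x0 where "x0 = (\<chi> j. \<lfloor>\<xi> $ j\<rfloor>)"
          have zero: "\<xi> \<notin> ?q x" if "x \<noteq> x0" for x using floor[of \<xi> x] that by (auto simp: x0_def)
          have "(\<Sum>x\<in>F. ennreal (?w x) * indicator (?q x) \<xi>) = (\<Sum>x\<in>F. if x = x0 then ennreal (?w x) * indicator (?q x) \<xi> else 0)"
            using zero by (intro sum.cong) auto
          also have "\<dots> \<le> ennreal (?w x0) * indicator (?q x0) \<xi>"
            using u(4) by (simp add: sum.delta)
          also have "\<dots> \<le> ennreal (cell_extension W \<xi> * (cmod (U \<xi>))\<^sup>2)"
            using val[of \<xi> x0] by (auto simp: indicator_def cell_extension_def x0_def)
          finally show "(\<Sum>x\<in>F. ennreal (?w x) * indicator (?q x) \<xi>) \<le> ennreal (cell_extension W \<xi> * (cmod (U \<xi>))\<^sup>2)" .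
        qed
        also have "\<dots> \<le> ennreal H * (\<integral>\<^sup>+\<xi>. ennreal ((norm (gradient U \<xi>))\<^sup>2) \<partial>lebesgue)"
          using H test_function_H1_gradient[OF U] by (auto simp: hardy_bounds_euclidean_def)
        also have "\<dots> \<le> ennreal H * ennreal (K * E)"
          by (intro mult_left_mono grad) auto
        also have "\<dots> = ennreal (H * (K * E))"
          using H0 K u(3) by (simp add: ennreal_mult)
        finally have "(\<Sum>x\<in>F. ?w x) * (1/3) ^ CARD('d) \<le> H * (K * E)"
          using H0 K u(3) by (subst (asm) ennreal_le_iff) auto
        then show ?thesis by (simp add: power_divide field_simps)
      qed
      have "0 \<le> 3 ^ CARD('d) * K * H" using K H0 by simp
      then have "hardy_weight_lattice W" "hardy_const_lattice W \<le> 2 * (3 ^ CARD('d) * K * H)"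
        using hardy_lattice_from_finite_support[OF W _ bound] by blast+
      then show ?thesis by (simp add: C_def mult.assoc)
    qed
    obtain H0 where "H0 \<in> hardy_bounds_euclidean (cell_extension W)"
      using JW by (auto simp: hardy_weight_euclidean_def)
    moreover have "hardy_const_lattice W / C \<le> hardy_const_euclidean (cell_extension W)"
      unfolding hardy_const_euclidean_def
      by (rule cInf_greatest) (use * C \<open>H0 \<in> _\<close> in \<open>auto simp: field_simps\<close>)
    ultimately show ?thesis using * C by (auto simp: field_simps)
  qed
  with that show thesis by blast
qed

section \<open>The isocapacitary inequality\<close>

definition cube_mean :: "nat \<Rightarrow> (int ^ 'd::finite \<Rightarrow> complex) \<Rightarrow> int ^ 'd \<Rightarrow> complex" where
  "cube_mean k v y = (\<Sum>z\<in>lattice_box {0..<2 ^ k}. v (y + z)) / of_nat (card (lattice_box {0..<2 ^ k} :: (int ^ 'd) set))"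

lemma card_dyadic_cube: "card (lattice_box {0..<2 ^ k} :: (int ^ 'd::finite) set) = (2 ^ k) ^ CARD('d)"
  by (simp add: card_lattice_box nat_power_eq)

lemma mean_square_le:
  fixes f :: "'a \<Rightarrow> complex"
  shows "(cmod ((\<Sum>z\<in>Z. f z) / of_nat (card Z)))\<^sup>2 \<le> (\<Sum>z\<in>Z. (cmod (f z))\<^sup>2) / real (card Z)"
proof (cases "card Z = 0")
  case False
  have "(cmod (\<Sum>z\<in>Z. f z))\<^sup>2 \<le> (\<Sum>z\<in>Z. cmod (f z))\<^sup>2"
    by (intro power_mono norm_sum) simp
  also have "\<dots> \<le> (\<Sum>z\<in>Z. (cmod (f z))\<^sup>2) * real (card Z)"
    by (rule sum_squared_le_sum_of_squares)
  finally show ?thesis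
    using False by (simp add: norm_divide power_divide power2_eq_square divide_simps)
qed simp

text \<open>
  At scale \<open>2 ^ k\<close> the mean averages differences along vectors of length \<open>O(2 ^ k)\<close>, whose
  \<open>\<ell>\<^sup>2\<close> norms are controlled by the energy.
\<close>
lemma cube_mean_error:
  fixes v :: "int ^ 'd::finite \<Rightarrow> complex"
  assumes "Q0 v \<le> ennreal E" "0 \<le> E" "finite A"
  shows "(\<Sum>y\<in>A. (cmod (cube_mean k v y - v y))\<^sup>2) \<le> (real CARD('d) * 2 ^ k)\<^sup>2 * E"
proof -
  let ?Z = "lattice_box {0..<2 ^ k} :: (int ^ 'd) set"
  have Z: "finite ?Z" "0 < card ?Z" by (auto simp: finite_lattice_box card_dyadic_cube)
  have "(cmod (cube_mean k v y - v y))\<^sup>2 \<le> (\<Sum>z\<in>?Z. (cmod (v (y + z) - v y))\<^sup>2) / real (card ?Z)" for y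
  proof -
    have "cube_mean k v y - v y = (\<Sum>z\<in>?Z. v (y + z) - v y) / of_nat (card ?Z)"
      using Z(2) by (simp add: cube_mean_def sum_subtractf diff_divide_distrib)
    then show ?thesis by (simp only: mean_square_le)
  qed
  then have "(\<Sum>y\<in>A. (cmod (cube_mean k v y - v y))\<^sup>2)
      \<le> (\<Sum>y\<in>A. (\<Sum>z\<in>?Z. (cmod (v (y + z) - v y))\<^sup>2) / real (card ?Z))"
    by (intro sum_mono)
  also have "\<dots> = (\<Sum>z\<in>?Z. \<Sum>y\<in>A. (cmod (v (y + z) - v y))\<^sup>2) / real (card ?Z)"
    by (subst sum.swap) (simp add: sum_divide_distrib)
  also have "\<dots> \<le> (\<Sum>z\<in>?Z. (real CARD('d) * real (2 ^ k))\<^sup>2 * E) / real (card ?Z)"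
  proof (intro divide_right_mono sum_mono sum_shift_energy_le assms)
    fix z :: "int ^ 'd" and j assume "z \<in> ?Z"
    then have "0 \<le> z $ j" "z $ j < 2 ^ k" by (auto simp: lattice_box_def)
    then show "\<bar>z $ j\<bar> \<le> int (2 ^ k)" by simp
  qed simp
  also have "\<dots> = (real CARD('d) * 2 ^ k)\<^sup>2 * E" using Z(2) by simp
  finally show ?thesis .
qed

text \<open>
  The difference of means at consecutive scales averages \<open>v(y + w) - v(y + z)\<close> over all pairs of points
  of the two cubes.  Grouping the pairs by \<open>e = w - z\<close> leaves \<open>O(2^(k d))\<close> translations, each contributing
  at most \<open>O(4 ^ k) E\<close>, against \<open>2^(k d) 2^((k + 1) d)\<close> pairs.  The bound is pointwise in \<open>y\<close>
  because the sum over \<open>z\<close> in the smaller cube plays the role of the sum over base points in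
  \<open>sum_shift_energy_le\<close>.
\<close>
lemma cube_mean_step:
  fixes v :: "int ^ 'd::finite \<Rightarrow> complex"
  assumes "Q0 v \<le> ennreal E" "0 \<le> E"
  shows "(cmod (cube_mean (Suc k) v y - cube_mean k v y))\<^sup>2
     \<le> 4 * (real CARD('d))\<^sup>2 * (3 / 2) ^ CARD('d) * E * (4 ^ k / (2 ^ CARD('d)) ^ k)"
proof -
  let ?Z = "lattice_box {0..<2 ^ k} :: (int ^ 'd) set" and ?W = "lattice_box {0..<2 ^ Suc k} :: (int ^ 'd) set"
  let ?S = "lattice_box {- (2 ^ k)..<2 ^ Suc k} :: (int ^ 'd) set"
  let ?d = "CARD('d)"
  have fin: "finite ?Z" "finite ?W" "finite ?S" by (simp_all add: finite_lattice_box)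
  have card: "card ?Z = (2 ^ k) ^ ?d" "card ?W = (2 ^ Suc k) ^ ?d" "card ?S = (3 * 2 ^ k) ^ ?d"
  proof -
    show "card ?Z = (2 ^ k) ^ ?d" "card ?W = (2 ^ Suc k) ^ ?d" by (rule card_dyadic_cube)+
    have "nat (2 ^ Suc k - - (2 ^ k)) = 3 * 2 ^ k"
      by (simp add: nat_eq_iff)
    then show "card ?S = (3 * 2 ^ k) ^ ?d" by (simp add: card_lattice_box)
  qed
  have pos: "real (card ?Z) > 0" "real (card ?W) > 0" by (simp_all only: card) simp_all
  have "cube_mean (Suc k) v y - cube_mean k v y
     = (\<Sum>(z, w)\<in>?Z \<times> ?W. v (y + w) - v (y + z)) / of_nat (card (?Z \<times> ?W))"
  proof -
    have "(\<Sum>(z, w)\<in>?Z \<times> ?W. v (y + w) - v (y + z))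
        = of_nat (card ?Z) * (\<Sum>w\<in>?W. v (y + w)) - of_nat (card ?W) * (\<Sum>z\<in>?Z. v (y + z))"
      by (simp add: sum.cartesian_product[symmetric] sum_subtractf sum_distrib_left)
    then show ?thesis
      using pos by (simp add: cube_mean_def card_cartesian_product field_simps)
  qed
  then have "(cmod (cube_mean (Suc k) v y - cube_mean k v y))\<^sup>2
     \<le> (\<Sum>p\<in>?Z \<times> ?W. (cmod (case p of (z, w) \<Rightarrow> v (y + w) - v (y + z)))\<^sup>2) / real (card (?Z \<times> ?W))"
    by (simp only: mean_square_le)
  also have "(\<Sum>p\<in>?Z \<times> ?W. (cmod (case p of (z, w) \<Rightarrow> v (y + w) - v (y + z)))\<^sup>2)
     = (\<Sum>z\<in>?Z. \<Sum>w\<in>?W. (cmod (v (y + w) - v (y + z)))\<^sup>2)"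
    by (simp add: sum.cartesian_product case_prod_unfold)
  also have "\<dots> \<le> (\<Sum>z\<in>?Z. \<Sum>e\<in>?S. (cmod (v (y + z + e) - v (y + z)))\<^sup>2)"
  proof (rule sum_mono)
    fix z assume z: "z \<in> ?Z"
    have "(\<Sum>w\<in>?W. (cmod (v (y + w) - v (y + z)))\<^sup>2)
       = (\<Sum>e\<in>(\<lambda>w. w - z) ` ?W. (cmod (v (y + z + e) - v (y + z)))\<^sup>2)"
      by (subst sum.reindex) (auto simp: inj_on_def)
    also have "\<dots> \<le> (\<Sum>e\<in>?S. (cmod (v (y + z + e) - v (y + z)))\<^sup>2)"
    proof (rule sum_mono2)
      show "(\<lambda>w. w - z) ` ?W \<subseteq> ?S"
      proof safe
        fix w assume w: "w \<in> ?W"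
        show "w - z \<in> ?S"
          unfolding lattice_box_def
        proof (intro CollectI allI)
          fix j
          have "0 \<le> w $ j" "w $ j < 2 ^ Suc k" "0 \<le> z $ j" "z $ j < 2 ^ k"
            using w z by (auto simp: lattice_box_def)
          then show "(w - z) $ j \<in> {- (2 ^ k)..<2 ^ Suc k}" by simp
        qed
      qed
    qed (use fin in auto)
    finally show "(\<Sum>w\<in>?W. (cmod (v (y + w) - v (y + z)))\<^sup>2) \<le> (\<Sum>e\<in>?S. (cmod (v (y + z + e) - v (y + z)))\<^sup>2)" .
  qed
  also have "\<dots> = (\<Sum>e\<in>?S. \<Sum>x\<in>(\<lambda>z. y + z) ` ?Z. (cmod (v (x + e) - v x))\<^sup>2)"
    by (subst sum.swap, subst sum.reindex) (auto simp: inj_on_def)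
  also have "\<dots> \<le> (\<Sum>e\<in>?S. (real ?d * real (2 ^ Suc k))\<^sup>2 * E)"
  proof (intro sum_mono sum_shift_energy_le assms)
    fix e :: "int ^ 'd" and j assume "e \<in> ?S"
    then have "- (2 ^ k) \<le> e $ j" "e $ j < 2 ^ Suc k" by (auto simp: lattice_box_def)
    then show "\<bar>e $ j\<bar> \<le> int (2 ^ Suc k)" by simp
  qed (use fin in auto)
  finally have "(cmod (cube_mean (Suc k) v y - cube_mean k v y))\<^sup>2
     \<le> (\<Sum>e\<in>?S. (real ?d * real (2 ^ Suc k))\<^sup>2 * E) / real (card (?Z \<times> ?W))"
    by (simp add: divide_right_mono)
  also have "\<dots> = real ((3 * 2 ^ k) ^ ?d) * ((real ?d * 2 ^ Suc k)\<^sup>2 * E) / ((2 ^ k) ^ ?d * (2 ^ Suc k) ^ ?d)"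
    by (simp only: card card_cartesian_product sum_constant) simp
  also have "\<dots> = 4 * (real CARD('d))\<^sup>2 * (3 / 2) ^ CARD('d) * E * (4 ^ k / (2 ^ CARD('d)) ^ k)"
  proof -
    have "(2 ^ Suc k :: real)\<^sup>2 = 4 * 4 ^ k"
      by (simp add: power2_eq_square flip: power_mult_distrib)
    moreover have "((2::real) ^ k) ^ ?d = (2 ^ ?d) ^ k"
      by (simp add: power_mult[symmetric] mult.commute)
    ultimately show ?thesis
      by (simp add: power_mult_distrib power_divide field_simps)
  qed
  finally show ?thesis .
qed

lemma cube_mean_tendsto_0:
  fixes v :: "int ^ 'd::finite \<Rightarrow> complex"
  assumes "finite {x. v x \<noteq> 0}"
  shows "(\<lambda>k. cube_mean k v y) \<longlonglongrightarrow> 0"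
proof (rule Lim_null_comparison)
  let ?T = "\<Sum>x\<in>{x. v x \<noteq> 0}. cmod (v x)"
  have "cmod (cube_mean k v y) \<le> ?T * (1 / 2) ^ k" for k
  proof -
    let ?Z = "lattice_box {0..<2 ^ k} :: (int ^ 'd) set"
    have Z: "finite ?Z" by (simp add: finite_lattice_box)
    have "cmod (\<Sum>z\<in>?Z. v (y + z)) \<le> (\<Sum>z\<in>?Z. cmod (v (y + z)))" by (rule norm_sum)
    also have "\<dots> = (\<Sum>x\<in>(\<lambda>z. y + z) ` ?Z. cmod (v x))"
      by (subst sum.reindex) (auto simp: inj_on_def)
    also have "\<dots> = (\<Sum>x\<in>(\<lambda>z. y + z) ` ?Z \<inter> {x. v x \<noteq> 0}. cmod (v x))"
      by (rule sum.mono_neutral_right) (use Z in auto)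
    also have "\<dots> \<le> ?T" by (rule sum_mono2) (use assms in auto)
    finally have 1: "cmod (\<Sum>z\<in>?Z. v (y + z)) \<le> ?T" .
    have "(2::real) ^ k \<le> (2 ^ k) ^ CARD('d)"
      by (rule self_le_power) auto
    then have "cmod (\<Sum>z\<in>?Z. v (y + z)) / (2 ^ k) ^ CARD('d) \<le> ?T / 2 ^ k"
      using 1 by (intro frac_le) (auto intro: sum_nonneg)
    then show ?thesis
      by (simp add: cube_mean_def card_dyadic_cube norm_divide norm_power power_divide)
  qed
  then show "\<forall>\<^sub>F k in sequentially. norm (cube_mean k v y) \<le> ?T * (1 / 2) ^ k" by simp
  show "(\<lambda>k. ?T * (1 / 2) ^ k) \<longlonglongrightarrow> 0"
    by (intro tendsto_mult_right_zero LIMSEQ_power_zero) simp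
qed

text \<open>
  The steps from scale \<open>i\<close> to \<open>i + 1\<close> decay like \<open>\<beta> ^ i\<close> with \<open>\<beta>\<^sup>2 = 2^(2 - d)\<close>, and the means tend
  to 0.  For \<open>d \<ge> 3\<close> one has \<open>\<beta> \<le> 3/4\<close>, so the tail of the geometric series from scale \<open>k\<close> on is at most
  \<open>4 \<beta> ^ k\<close>.
\<close>
lemma cube_mean_bound:
  fixes v :: "int ^ 'd::finite \<Rightarrow> complex"
  assumes d: "CARD('d) \<ge> 3" and fin: "finite {x. v x \<noteq> 0}" and E: "Q0 v \<le> ennreal E" "0 \<le> E"
  shows "(cmod (cube_mean k v y))\<^sup>2
     \<le> 64 * (real CARD('d))\<^sup>2 * (3 / 2) ^ CARD('d) * E / (2 ^ (CARD('d) - 2)) ^ k"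
proof -
  define c where "c = 4 * (real CARD('d))\<^sup>2 * (3 / 2) ^ CARD('d) * E"
  define \<rho> where "\<rho> = 1 / (2::real) ^ (CARD('d) - 2)"
  define \<beta> where "\<beta> = sqrt \<rho>"
  have c: "0 \<le> c" using E by (simp add: c_def)
  have "(2::real) ^ 1 \<le> 2 ^ (CARD('d) - 2)" using d by (intro power_increasing) auto
  then have \<rho>: "0 < \<rho>" "\<rho> \<le> 1 / 2" by (auto simp: \<rho>_def field_simps)
  have \<beta>: "0 \<le> \<beta>" "\<beta> \<le> 3 / 4" "\<beta>\<^sup>2 = \<rho>"
  proof -
    have "\<beta> \<le> sqrt ((3 / 4)\<^sup>2)"
      unfolding \<beta>_def using \<rho> by (intro real_sqrt_le_mono) (simp add: power2_eq_square)
    then show "\<beta> \<le> 3 / 4" by simp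
  qed (use \<rho> in \<open>auto simp: \<beta>_def\<close>)
  have \<beta>_pow: "(\<beta> ^ i)\<^sup>2 = \<rho> ^ i" for i
    by (simp only: \<beta>(3)[symmetric] power_mult[symmetric] mult.commute[of i 2])
  have ratio: "4 ^ i / (2 ^ CARD('d)) ^ i = \<rho> ^ i" for i
  proof -
    have "(2::real) ^ CARD('d) = 2 ^ 2 * 2 ^ (CARD('d) - 2)"
      using d by (metis power_add le_add_diff_inverse Suc_leD numeral_2_eq_2 numeral_3_eq_3)
    then show ?thesis by (simp add: \<rho>_def power_divide power_mult_distrib)
  qed
  have step: "cmod (cube_mean (Suc i) v y - cube_mean i v y) \<le> sqrt c * \<beta> ^ i" for i
  proof -
    have "(cmod (cube_mean (Suc i) v y - cube_mean i v y))\<^sup>2 \<le> c * \<rho> ^ i"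
      using cube_mean_step[OF E, of i y] by (simp add: ratio c_def)
    also have "\<dots> = (sqrt c * \<beta> ^ i)\<^sup>2"
      using c by (simp add: power_mult_distrib \<beta>_pow)
    finally show ?thesis by (rule power2_le_imp_le) (use c \<beta> in auto)
  qed
  \<comment> \<open>The correction term turns the telescoping estimate into monotonicity: \<open>a\<close> increases to 0.\<close>
  define a where "a i = cmod (cube_mean i v y) - 4 * sqrt c * \<beta> ^ i" for i
  have "incseq a"
  proof (rule incseq_SucI)
    fix i
    have "cmod (cube_mean i v y) \<le> cmod (cube_mean (Suc i) v y) + sqrt c * \<beta> ^ i"
      using step[of i] norm_triangle_ineq2[of "cube_mean i v y" "cube_mean (Suc i) v y"]
      by (simp add: norm_minus_commute)
    moreover have "sqrt c * \<beta> ^ i * 1 \<le> sqrt c * \<beta> ^ i * (4 * (1 - \<beta>))"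
      using c \<beta> by (intro mult_left_mono) auto
    ultimately show "a i \<le> a (Suc i)" by (simp add: a_def algebra_simps)
  qed
  moreover have "a \<longlonglongrightarrow> 0 - 0"
    unfolding a_def
  proof (rule tendsto_diff)
    show "(\<lambda>i. cmod (cube_mean i v y)) \<longlonglongrightarrow> 0"
      using cube_mean_tendsto_0[OF fin] by (rule tendsto_norm_zero)
    show "(\<lambda>i. 4 * sqrt c * \<beta> ^ i) \<longlonglongrightarrow> 0"
      using \<beta> by (intro tendsto_mult_right_zero LIMSEQ_power_zero) simp
  qed
  ultimately have "a k \<le> 0" by (metis diff_self incseq_le)
  then have "cmod (cube_mean k v y) \<le> 4 * sqrt c * \<beta> ^ k" by (simp add: a_def)
  then have "(cmod (cube_mean k v y))\<^sup>2 \<le> (4 * sqrt c * \<beta> ^ k)\<^sup>2" by (rule power_mono) simp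
  also have "\<dots> = 16 * c * \<rho> ^ k"
    using c by (simp add: power_mult_distrib \<beta>_pow)
  also have "\<dots> = 64 * (real CARD('d))\<^sup>2 * (3 / 2) ^ CARD('d) * E / (2 ^ (CARD('d) - 2)) ^ k"
    by (simp add: c_def \<rho>_def power_divide)
  finally show ?thesis .
qed

text \<open>
  Let \<open>k\<close> be the first scale at which \<open>cube_mean_bound\<close> makes all means at most 1/2.  On \<open>A\<close> the
  function then differs from its mean by at least 1/2, so \<open>card A\<close> is at most four times the squared
  \<open>\<ell>\<^sup>2\<close> error at scale \<open>k\<close>, that is \<open>O(4 ^ k E)\<close>.  Minimality of \<open>k\<close> gives \<open>2^(k (d - 2)) = O(E)\<close> if
  \<open>k > 0\<close>, and if \<open>k = 0\<close> then \<open>A\<close> is empty, the mean at scale 0 being the function itself.  The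
  inequality is stated with natural exponents to postpone the extraction of roots.
\<close>
lemma card_level_set_le:
  fixes v :: "int ^ 'd::finite \<Rightarrow> complex"
  assumes d: "CARD('d) \<ge> 3" and fin: "finite {x. v x \<noteq> 0}" and E: "Q0 v \<le> ennreal E" "0 \<le> E"
    and A: "\<And>x. x \<in> A \<Longrightarrow> 1 \<le> cmod (v x)"
    and c_def: "c = 2 ^ (CARD('d) - 2) * 256 * (real CARD('d))\<^sup>2 * (3 / 2) ^ CARD('d)"
  shows "real (card A) ^ (CARD('d) - 2) \<le> (4 * (real CARD('d))\<^sup>2) ^ (CARD('d) - 2) * c\<^sup>2 * E ^ CARD('d)"
proof -
  let ?d = "real CARD('d)" and ?p = "(2::real) ^ (CARD('d) - 2)"
  have finA: "finite A" by (rule finite_subset[OF _ fin]) (use A in force)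
  have p: "2 \<le> ?p" using power_increasing[of 1 "CARD('d) - 2" "2::real"] d by simp
  \<comment> \<open>\<open>b \<le> ?p ^ k\<close> is the condition under which \<open>cube_mean_bound\<close> yields means of modulus at most 1/2.\<close>
  define b where "b = 256 * ?d\<^sup>2 * (3 / 2) ^ CARD('d) * E"
  have b: "0 \<le> b" using E by (simp add: b_def)
  have "\<exists>k. b \<le> ?p ^ k"
    using real_arch_pow[of ?p b] p by (auto intro: less_imp_le)
  then obtain k where k: "b \<le> ?p ^ k" "\<And>i. i < k \<Longrightarrow> ?p ^ i < b"
    using exists_least_iff[of "\<lambda>k. b \<le> ?p ^ k"] by (auto simp: not_le)
  have mean: "cmod (cube_mean k v y) \<le> 1 / 2" for y
  proof (rule power2_le_imp_le)
    have "(cmod (cube_mean k v y))\<^sup>2 \<le> (b / 4) / ?p ^ k"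
    proof -
      have "b / 4 = 64 * ?d\<^sup>2 * (3 / 2) ^ CARD('d) * E" by (simp add: b_def)
      then show ?thesis using cube_mean_bound[OF d fin E, of k y] by (simp only:)
    qed
    also have "\<dots> \<le> 1 / 4" using k(1) p by (simp add: divide_simps)
    finally show "(cmod (cube_mean k v y))\<^sup>2 \<le> (1 / 2)\<^sup>2" by (simp add: power2_eq_square)
  qed simp
  show ?thesis
  proof (cases k)
    case 0
    have singleton: "{0..<1} = {0::int}" by auto
    have "lattice_box {0..<1} = {0 :: int ^ 'd}"
      unfolding singleton lattice_box_def by (auto simp: vec_eq_iff)
    then have "cube_mean k v y = v y" for y by (simp add: cube_mean_def 0)
    then have small: "cmod (v y) \<le> 1 / 2" for y using mean[of y] by simp
    have "y \<notin> A" for y using A[of y] small[of y] by linarith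
    then have "A = {}" by blast
    moreover have "CARD('d) - 2 > 0" using d by simp
    ultimately have "real (card A) ^ (CARD('d) - 2) = 0" by (simp add: zero_power)
    also have "0 \<le> (4 * ?d\<^sup>2) ^ (CARD('d) - 2) * c\<^sup>2 * E ^ CARD('d)" using E by simp
    finally show ?thesis .
  next
    case (Suc i)
    then have "?p ^ k \<le> ?p * b" using k(2)[of i] p by simp
    also have "\<dots> = c * E" by (simp add: b_def c_def)
    finally have pk: "?p ^ k \<le> c * E" .
    have "real (card A) * (1 / 4) = (\<Sum>y\<in>A. (1 / 2)\<^sup>2)" by (simp add: power2_eq_square)
    also have "\<dots> \<le> (\<Sum>y\<in>A. (cmod (cube_mean k v y - v y))\<^sup>2)"
    proof (intro sum_mono power_mono)
      fix y assume "y \<in> A"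
      then show "1 / 2 \<le> cmod (cube_mean k v y - v y)"
        using A[of y] mean[of y] norm_triangle_ineq2[of "v y" "cube_mean k v y"]
        by (simp add: norm_minus_commute)
    qed simp
    also have "\<dots> \<le> (?d * 2 ^ k)\<^sup>2 * E" by (rule cube_mean_error[OF E finA])
    finally have "real (card A) \<le> 4 * ?d\<^sup>2 * (2 ^ k)\<^sup>2 * E" by (simp add: power_mult_distrib)
    then have "real (card A) ^ (CARD('d) - 2) \<le> (4 * ?d\<^sup>2 * (2 ^ k)\<^sup>2 * E) ^ (CARD('d) - 2)"
      by (rule power_mono) simp
    also have "\<dots> = (4 * ?d\<^sup>2) ^ (CARD('d) - 2) * (?p ^ k)\<^sup>2 * E ^ (CARD('d) - 2)"
      by (simp add: power_mult_distrib power_mult[symmetric] mult_ac)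
    also have "\<dots> \<le> (4 * ?d\<^sup>2) ^ (CARD('d) - 2) * (c * E)\<^sup>2 * E ^ (CARD('d) - 2)"
      using pk E p by (intro mult_right_mono mult_left_mono power_mono) auto
    also have "\<dots> = (4 * ?d\<^sup>2) ^ (CARD('d) - 2) * c\<^sup>2 * (E ^ 2 * E ^ (CARD('d) - 2))"
      by (simp add: power_mult_distrib)
    also have "E ^ 2 * E ^ (CARD('d) - 2) = E ^ CARD('d)"
      using d by (metis power_add le_add_diff_inverse Suc_leD numeral_2_eq_2 numeral_3_eq_3)
    finally show ?thesis .
  qed
qed

lemma isocapacitary_inequality:
  assumes d: "CARD('d::finite) \<ge> 3"
  obtains C :: real where "C > 0"
    and "\<And>(v :: int ^ 'd \<Rightarrow> complex) E A. finite {x. v x \<noteq> 0} \<Longrightarrow> Q0 v \<le> ennreal E \<Longrightarrow> 0 \<le> E \<Longrightarrow>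
      (\<And>x. x \<in> A \<Longrightarrow> 1 \<le> cmod (v x)) \<Longrightarrow> real (card A) powr (1 - 2 / real CARD('d)) \<le> C * E"
proof -
  let ?d = "CARD('d)"
  define c where "c = 2 ^ (CARD('d) - 2) * 256 * (real CARD('d))\<^sup>2 * (3 / 2) ^ CARD('d)"
  define C where "C = (4 * (real ?d)\<^sup>2) ^ (?d - 2) * c\<^sup>2"
  have C: "C > 0" by (simp add: C_def c_def)
  have "real (card A) powr (1 - 2 / real ?d) \<le> C powr (1 / real ?d) * E"
    if "finite {x. v x \<noteq> 0}" "Q0 v \<le> ennreal E" "0 \<le> E" "\<And>x. x \<in> A \<Longrightarrow> 1 \<le> cmod (v x)"
    for v :: "int ^ 'd \<Rightarrow> complex" and E A
  proof (cases "card A = 0")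
    case False
    then have m: "real (card A) > 0" by simp
    have "real (card A) powr (1 - 2 / real ?d) = (real (card A) ^ (?d - 2)) powr (1 / real ?d)"
      using d m by (simp add: powr_realpow[symmetric] powr_powr of_nat_diff field_simps)
    also have "\<dots> \<le> (C * E ^ ?d) powr (1 / real ?d)"
      using card_level_set_le[OF d that c_def] by (intro powr_mono2) (auto simp: C_def)
    also have "\<dots> = C powr (1 / real ?d) * (E ^ ?d) powr (1 / real ?d)"
      using C that by (simp add: powr_mult)
    also have "(E ^ ?d) powr (1 / real ?d) = E"
      using that(3) by (cases "E = 0") (auto simp: powr_realpow[symmetric] powr_powr)
    finally show ?thesis .
  qed (use that C in auto)
  with that[of "C powr (1 / real ?d)"] C show thesis by simp
qed


section \<open>Weights in weak sequence spaces\<close>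

text \<open>
  A discrete form of \<open>(1 - \<alpha>) t^(-\<alpha>) = (t^(1 - \<alpha>))'\<close>, which drives the next induction.
\<close>
lemma powr_increment:
  fixes \<alpha> :: real
  assumes "0 < \<alpha>" "\<alpha> < 1" "m \<ge> (1::nat)"
  shows "(1 - \<alpha>) * real m powr - \<alpha> + real (m - 1) powr (1 - \<alpha>) \<le> real m powr (1 - \<alpha>)"
proof (cases "m = 1")
  case False
  then have m: "real m > 0" "m > 1" using assms by auto
  have "real (m - 1) powr (1 - \<alpha>) * real m powr \<alpha> \<le> (1 - \<alpha>) * real (m - 1) + \<alpha> * real m"
    by (rule Youngs_inequality_0) (use assms m in auto)
  also have "\<dots> = real m - (1 - \<alpha>)" using assms by (simp add: of_nat_diff algebra_simps)
  finally have "real (m - 1) powr (1 - \<alpha>) * real m powr \<alpha> * real m powr - \<alpha> \<le> (real m - (1 - \<alpha>)) * real m powr - \<alpha>"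
    by (rule mult_right_mono) simp
  moreover have "real (m - 1) powr (1 - \<alpha>) * real m powr \<alpha> * real m powr - \<alpha> = real (m - 1) powr (1 - \<alpha>)"
    using m by (simp add: mult.assoc flip: powr_add)
  moreover have "(real m - (1 - \<alpha>)) * real m powr - \<alpha> = real m powr (1 - \<alpha>) - (1 - \<alpha>) * real m powr - \<alpha>"
    using m by (simp add: left_diff_distrib[of "real m"] powr_mult_base)
  ultimately show ?thesis by linarith
qed (use assms in simp)

text \<open>
  If \<open>a\<close> minimises \<open>W\<close> on a set of \<open>m\<close> points, then all \<open>m\<close> points lie above every level
  \<open>s < W a\<close>, so \<open>W a \<le> N m^(-\<alpha>)\<close>.  Removing such a minimiser repeatedly bounds the sum by
  \<open>N \<Sum> j^(-\<alpha>)\<close> over \<open>j \<le> m\<close>.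
\<close>
lemma sum_le_weak_bound:
  fixes W :: "'a \<Rightarrow> real"
  assumes W: "\<And>x. 0 \<le> W x" and \<alpha>: "0 < \<alpha>" "\<alpha> < 1" and N: "0 \<le> N"
    and weak: "\<And>s. 0 < s \<Longrightarrow> finite {x. W x > s} \<and> s * real (card {x. W x > s}) powr \<alpha> \<le> N"
    and "finite A"
  shows "(\<Sum>x\<in>A. W x) \<le> N / (1 - \<alpha>) * real (card A) powr (1 - \<alpha>)"
  using \<open>finite A\<close>
proof (induction "card A" arbitrary: A rule: less_induct)
  case (less A)
  show ?case
  proof (cases "A = {}")
    case False
    define m where "m = card A"
    have m: "m \<ge> 1" using False less.prems by (simp add: m_def Suc_leI card_gt_0_iff)
    obtain a where a: "a \<in> A" "\<And>x. x \<in> A \<Longrightarrow> W a \<le> W x"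
      using ex_min_if_finite[OF finite_imageI[OF less.prems, of W]] False
      by (metis (no_types, lifting) arg_min_if_finite(1) arg_min_least less.prems)
    have "W a \<le> N * real m powr - \<alpha>"
    proof (rule ccontr)
      assume "\<not> W a \<le> N * real m powr - \<alpha>"
      then obtain s where s: "N * real m powr - \<alpha> < s" "s < W a" using dense by (metis not_le)
      have "0 \<le> N * real m powr - \<alpha>" using N by simp
      with s have "0 < s" by linarith
      have "A \<subseteq> {x. W x > s}" using a s by (auto intro: less_le_trans)
      then have "m \<le> card {x. W x > s}"
        using weak[OF \<open>0 < s\<close>] by (simp add: m_def card_mono)
      then have "s * real m powr \<alpha> \<le> s * real (card {x. W x > s}) powr \<alpha>"
        using \<alpha> \<open>0 < s\<close> by (intro mult_left_mono powr_mono2) auto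
      also have "\<dots> \<le> N" using weak[OF \<open>0 < s\<close>] by simp
      finally have "s * real m powr \<alpha> * real m powr - \<alpha> \<le> N * real m powr - \<alpha>"
        by (rule mult_right_mono) simp
      then show False using s m by (simp add: mult.assoc flip: powr_add)
    qed
    moreover have "(\<Sum>x\<in>A - {a}. W x) \<le> N / (1 - \<alpha>) * real (m - 1) powr (1 - \<alpha>)"
      using less.hyps[of "A - {a}"] less.prems a m by (simp add: m_def)
    ultimately have "(\<Sum>x\<in>A. W x) \<le> N * real m powr - \<alpha> + N / (1 - \<alpha>) * real (m - 1) powr (1 - \<alpha>)"
      using a less.prems by (subst sum.remove[of _ a]) auto
    also have "\<dots> = N / (1 - \<alpha>) * ((1 - \<alpha>) * real m powr - \<alpha> + real (m - 1) powr (1 - \<alpha>))"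
      using \<alpha> by (simp add: field_simps)
    also have "\<dots> \<le> N / (1 - \<alpha>) * real m powr (1 - \<alpha>)"
      using N \<alpha> powr_increment[OF \<alpha> m] by (intro mult_left_mono) auto
    finally show ?thesis by (simp add: m_def)
  qed simp
qed


section \<open>Truncation into dyadic layers\<close>

text \<open>
  For nonnegative arguments this is the length of \<open>[0, t] \<inter> [height, 2 * height]\<close>.
\<close>
definition layer :: "real \<Rightarrow> real \<Rightarrow> real" where
  "layer height t = min (max (t - height) 0) height"

lemma layer_mono: "s \<le> t \<Longrightarrow> layer height s \<le> layer height t"
  by (auto simp: layer_def)

lemma sum_layers:
  assumes "c > 0"
  shows "(\<Sum>k<n. layer (c * 2 ^ k) t) = min (max t c) (c * 2 ^ n) - c"
proof (induction n)
  case 0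
  then show ?case using assms by auto
next
  case (Suc n)
  have "c * 1 \<le> c * 2 ^ n" using assms by (intro mult_left_mono) auto
  then have "layer (c * 2 ^ n) t + (min (max t c) (c * 2 ^ n) - c) = min (max t c) (2 * (c * 2 ^ n)) - c"
    using assms unfolding layer_def min_def max_def by (smt (verit))
  with Suc show ?case by (simp add: mult.left_commute)
qed

text \<open>
  The layer maps are monotone and sum up to a truncation, which is 1-Lipschitz.  Their increments therefore
  have equal signs and total at most \<open>|s - t|\<close>, and a sum of squares is at most the square of the sum.
  Applied along edges, this bounds the total energy of the layers of \<open>\<phi>\<close> by the energy of \<open>\<phi>\<close>.
\<close>
lemma sum_layer_differences:
  assumes "c > 0"
  shows "(\<Sum>k<n. (layer (c * 2 ^ k) s - layer (c * 2 ^ k) t)\<^sup>2) \<le> (s - t)\<^sup>2"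
proof -
  have *: "(\<Sum>k<n. (layer (c * 2 ^ k) s - layer (c * 2 ^ k) t)\<^sup>2) \<le> (s - t)\<^sup>2" if "t \<le> s" for s t
  proof -
    let ?f = "\<lambda>k. layer (c * 2 ^ k) s - layer (c * 2 ^ k) t"
    have nn: "0 \<le> ?f k" for k using layer_mono[OF that] by simp
    have "L2_set ?f {..<n} \<le> (\<Sum>k<n. ?f k)" by (rule L2_set_le_sum) (rule nn)
    also have "\<dots> \<le> s - t"
      using that by (auto simp: sum_subtractf sum_layers[OF assms] min_def max_def)
    finally have "(L2_set ?f {..<n})\<^sup>2 \<le> (s - t)\<^sup>2" by (rule power_mono) simp
    then show ?thesis by (simp add: L2_set_def sum_nonneg)
  qed
  show ?thesis
    using *[of s t] *[of t s] by (cases "t \<le> s") (auto simp: power2_commute)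
qed

lemma dyadic_level:
  fixes c t :: real
  assumes "c > 0" "2 * c \<le> t" "t \<le> c * 2 ^ n"
  obtains k where "k < n" "2 * (c * 2 ^ k) \<le> t" "t \<le> 4 * (c * 2 ^ k)"
proof -
  obtain N where "t / c < 2 ^ N" using real_arch_pow[of 2 "t / c"] by auto
  then have "t \<le> 4 * (c * 2 ^ N)" using assms by (simp add: field_simps)
  then obtain k where k: "t \<le> 4 * (c * 2 ^ k)" "\<And>i. i < k \<Longrightarrow> \<not> t \<le> 4 * (c * 2 ^ i)"
    using exists_least_iff[of "\<lambda>k. t \<le> 4 * (c * 2 ^ k)"] by auto
  have low: "2 * (c * 2 ^ k) \<le> t"
  proof (cases k)
    case (Suc i)
    then show ?thesis using k(2)[of i] by simp
  qed (use assms in simp)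
  have "c * 2 ^ Suc k = 2 * (c * 2 ^ k)" by simp
  also have "\<dots> \<le> c * 2 ^ n" using low assms(3) by (rule order_trans)
  finally have "(2::real) ^ Suc k \<le> 2 ^ n" using assms(1) by (simp only: mult_le_cancel_left_pos)
  then have "Suc k \<le> n" by (rule power_le_imp_le_exp[rotated]) simp
  then have "k < n" by simp
  from that[OF this low k(1)] show thesis .
qed

text \<open>
  Maz'ya's truncation.  With heights \<open>c 2^k\<close>, where \<open>2 c\<close> is at most the least nonzero value of \<open>|\<phi>|\<close>, every
  point of the support lies in some dyadic range \<open>2 c 2^k \<le> |\<phi>| \<le> 4 c 2^k\<close>.  On the set \<open>A k\<close> above the
  lower end of that range the \<open>k\<close>-th layer is full, so that it is a competitor for the capacity of \<open>A k\<close>.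
\<close>
lemma hardy_inequality_from_weak_bound:
  fixes W :: "int ^ 'd::finite \<Rightarrow> real" and \<phi> :: "int ^ 'd \<Rightarrow> complex"
  assumes W: "\<And>x. 0 \<le> W x" and C: "0 \<le> C" and D: "0 \<le> D"
    and weight: "\<And>A. finite A \<Longrightarrow> (\<Sum>x\<in>A. W x) \<le> D * real (card A) powr \<theta>"
    and capacity: "\<And>(v :: int ^ 'd \<Rightarrow> complex) E A. finite {x. v x \<noteq> 0} \<Longrightarrow> Q0 v \<le> ennreal E \<Longrightarrow> 0 \<le> E \<Longrightarrow>
      (\<And>x. x \<in> A \<Longrightarrow> 1 \<le> cmod (v x)) \<Longrightarrow> real (card A) powr \<theta> \<le> C * E"
    and fin: "finite {x. \<phi> x \<noteq> 0}" and E: "Q0 \<phi> = ennreal E" "0 \<le> E" and F: "finite F"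
  shows "(\<Sum>x\<in>F. W x * (cmod (\<phi> x))\<^sup>2) \<le> (16 * D * C) * E"
proof -
  define S where "S = {x. \<phi> x \<noteq> 0}"
  have S: "finite S" using fin by (simp add: S_def)
  obtain c where c: "c > 0" "\<And>x. x \<in> S \<Longrightarrow> 2 * c \<le> cmod (\<phi> x)"
  proof
    \<comment> \<open>Inserting 1 keeps the minimum defined when the support is empty.\<close>
    define c where "c = Min (insert 1 ((\<lambda>x. cmod (\<phi> x)) ` S)) / 2"
    show "c > 0" using S by (auto simp: c_def S_def Min_gr_iff)
    show "2 * c \<le> cmod (\<phi> x)" if "x \<in> S" for x
      using S that by (auto simp: c_def intro: Min_le)
  qed
  obtain n where n: "\<And>x. x \<in> S \<Longrightarrow> cmod (\<phi> x) \<le> c * 2 ^ n"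
  proof -
    obtain n where n: "(\<Sum>x\<in>S. cmod (\<phi> x)) / c < 2 ^ n" using real_arch_pow[of 2] by auto
    show thesis
    proof (rule that)
      fix x assume "x \<in> S"
      then have "cmod (\<phi> x) \<le> (\<Sum>x\<in>S. cmod (\<phi> x))" using S by (intro member_le_sum) auto
      also have "\<dots> \<le> c * 2 ^ n" using n c by (simp add: field_simps)
      finally show "cmod (\<phi> x) \<le> c * 2 ^ n" .
    qed
  qed
  obtain B where B: "finite B" "\<And>x j. x + axis j 1 \<in> {x. \<phi> x \<noteq> 0} \<or> \<phi> x \<noteq> 0 \<Longrightarrow> x \<in> B"
    using finite_edges_of_finite_support[OF fin] by blast
  define height where "height k = c * 2 ^ k" for k :: nat
  have height: "0 < height k" for k using c by (simp add: height_def)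
  \<comment> \<open>Normalised layers, equal to 1 on \<open>A k\<close>.\<close>
  define v where "v k x = complex_of_real (layer (height k) (cmod (\<phi> x)) / height k)" for k x
  have v0: "v k x = 0" if "\<phi> x = 0" for k x
    using that height[of k] by (simp add: v_def layer_def)
  define A where "A k = {x\<in>S. 2 * height k \<le> cmod (\<phi> x)}" for k
  have finA: "finite (A k)" for k using S by (simp add: A_def)
  have cap: "real (card (A k)) powr \<theta> \<le> C * edge_energy B (v k)" for k
  proof (rule capacity)
    show "finite {x. v k x \<noteq> 0}" by (rule finite_subset[OF _ fin]) (use v0 in auto)
    have "Q0 (v k) = ennreal (edge_energy B (v k))"
    proof (rule Q0_eq_edge_energy[OF B(1)])
      fix x j assume "v k (x + axis j 1) \<noteq> v k x"
      then have "\<phi> (x + axis j 1) \<noteq> 0 \<or> \<phi> x \<noteq> 0" using v0 by metis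
      then show "x \<in> B" using B(2)[of x j] by simp
    qed
    then show "Q0 (v k) \<le> ennreal (edge_energy B (v k))" by simp
    show "1 \<le> cmod (v k x)" if "x \<in> A k" for x
    proof -
      have "layer (height k) (cmod (\<phi> x)) = height k" using that by (auto simp: A_def layer_def)
      then show ?thesis using height[of k] by (simp add: v_def)
    qed
  qed (rule edge_energy_nonneg)
  have energy: "(\<Sum>k<n. (height k)\<^sup>2 * edge_energy B (v k)) \<le> E"
  proof -
    have edge: "(\<Sum>k<n. (height k)\<^sup>2 * (cmod (v k y - v k x))\<^sup>2) \<le> (cmod (\<phi> y - \<phi> x))\<^sup>2" for x y
    proof -
      have "(height k)\<^sup>2 * (cmod (v k y - v k x))\<^sup>2 = (layer (c * 2 ^ k) (cmod (\<phi> y)) - layer (c * 2 ^ k) (cmod (\<phi> x)))\<^sup>2" for k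
      proof -
        have "v k y - v k x = complex_of_real ((layer (height k) (cmod (\<phi> y)) - layer (height k) (cmod (\<phi> x))) / height k)"
          by (simp add: v_def diff_divide_distrib)
        then have "cmod (v k y - v k x) = \<bar>layer (height k) (cmod (\<phi> y)) - layer (height k) (cmod (\<phi> x))\<bar> / height k"
          using height[of k] by (simp only: norm_of_real) (simp add: abs_divide)
        then show ?thesis using height[of k] c(1) by (simp add: power_divide height_def)
      qed
      then have "(\<Sum>k<n. (height k)\<^sup>2 * (cmod (v k y - v k x))\<^sup>2) \<le> (cmod (\<phi> y) - cmod (\<phi> x))\<^sup>2"
        using sum_layer_differences[OF c(1)] by simp
      also have "\<dots> \<le> (cmod (\<phi> y - \<phi> x))\<^sup>2"
        using norm_triangle_ineq3[of "\<phi> y" "\<phi> x"] by (metis abs_le_square_iff abs_norm_cancel)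
      finally show ?thesis .
    qed
    have "(\<Sum>k<n. (height k)\<^sup>2 * edge_energy B (v k))
       = (\<Sum>x\<in>B. \<Sum>j\<in>UNIV. \<Sum>k<n. (height k)\<^sup>2 * (cmod (v k (x + axis j 1) - v k x))\<^sup>2)"
      unfolding edge_energy_def sum_distrib_left
      by (subst sum.swap) (intro sum.cong refl sum.swap)
    also have "\<dots> \<le> edge_energy B \<phi>"
      unfolding edge_energy_def by (intro sum_mono edge)
    also have "\<dots> \<le> E"
      using edge_energy_le_Q0[OF B(1), of \<phi>] E by simp
    finally show ?thesis .
  qed
  have "(\<Sum>x\<in>F. W x * (cmod (\<phi> x))\<^sup>2) = (\<Sum>x\<in>F \<inter> S. W x * (cmod (\<phi> x))\<^sup>2)"
    by (rule sum.mono_neutral_right) (use F in \<open>auto simp: S_def\<close>)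
  also have "\<dots> \<le> (\<Sum>x\<in>S. W x * (cmod (\<phi> x))\<^sup>2)"
    by (rule sum_mono2) (use S W in auto)
  also have "\<dots> \<le> (\<Sum>x\<in>S. W x * (16 * (\<Sum>k<n. (height k)\<^sup>2 * of_bool (x \<in> A k))))"
  proof (intro sum_mono mult_left_mono W)
    fix x assume x: "x \<in> S"
    obtain k where k: "k < n" "2 * height k \<le> cmod (\<phi> x)" "cmod (\<phi> x) \<le> 4 * height k"
      using dyadic_level[OF c(1) c(2)[OF x] n[OF x]] unfolding height_def by blast
    have "(cmod (\<phi> x))\<^sup>2 \<le> (4 * height k)\<^sup>2" using k by (intro power_mono) auto
    also have "\<dots> = 16 * ((height k)\<^sup>2 * of_bool (x \<in> A k))" using k x by (simp add: A_def power_mult_distrib)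
    also have "\<dots> \<le> 16 * (\<Sum>k<n. (height k)\<^sup>2 * of_bool (x \<in> A k))"
      using k by (intro mult_left_mono member_le_sum) auto
    finally show "(cmod (\<phi> x))\<^sup>2 \<le> 16 * (\<Sum>k<n. (height k)\<^sup>2 * of_bool (x \<in> A k))" .
  qed
  also have "\<dots> = 16 * (\<Sum>k<n. (height k)\<^sup>2 * (\<Sum>x\<in>A k. W x))"
  proof -
    have "(\<Sum>x\<in>S. W x * of_bool (x \<in> A k)) = (\<Sum>x\<in>A k. W x)" for k
      using S by (intro sum.mono_neutral_cong_right) (auto simp: A_def)
    moreover have "(\<Sum>x\<in>S. W x * (16 * (\<Sum>k<n. (height k)\<^sup>2 * of_bool (x \<in> A k))))
       = 16 * (\<Sum>k<n. (height k)\<^sup>2 * (\<Sum>x\<in>S. W x * of_bool (x \<in> A k)))"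
      unfolding sum_distrib_left by (subst sum.swap) (simp add: mult_ac)
    ultimately show ?thesis by simp
  qed
  also have "\<dots> \<le> 16 * (\<Sum>k<n. (height k)\<^sup>2 * (D * (C * edge_energy B (v k))))"
  proof (intro mult_left_mono sum_mono)
    fix k
    have "(\<Sum>x\<in>A k. W x) \<le> D * real (card (A k)) powr \<theta>" by (rule weight[OF finA])
    also have "\<dots> \<le> D * (C * edge_energy B (v k))" by (intro mult_left_mono cap D)
    finally show "(\<Sum>x\<in>A k. W x) \<le> D * (C * edge_energy B (v k))" .
  qed auto
  also have "\<dots> = (16 * D * C) * (\<Sum>k<n. (height k)\<^sup>2 * edge_energy B (v k))"
    by (simp add: sum_distrib_left mult_ac)
  also have "\<dots> \<le> (16 * D * C) * E"
    using energy C D by (intro mult_left_mono) auto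
  finally show ?thesis .
qed

text \<open>
  The weak space with index \<open>d/2\<close> is the right one because its weights and the isocapacitary inequality
  share the exponent \<open>1 - \<alpha> = 1 - 2/d\<close>, so that both bounds combine linearly on every level set.
\<close>
lemma hardy_lattice_of_weak_lq:
  assumes d: "CARD('d::finite) \<ge> 3"
  obtains C :: real where "\<And>W :: int ^ 'd \<Rightarrow> real. (\<And>x. 0 \<le> W x) \<Longrightarrow>
      W \<in> weak_lq (real CARD('d) / 2) \<Longrightarrow>
      hardy_weight_lattice W \<and> hardy_const_lattice W \<le> C * weak_lq_norm (real CARD('d) / 2) W"
proof -
  define \<alpha> where "\<alpha> = 1 / (real CARD('d) / 2)"
  have \<alpha>: "0 < \<alpha>" "\<alpha> < 1" "1 - 2 / real CARD('d) = 1 - \<alpha>" using d by (auto simp: \<alpha>_def field_simps)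
  obtain C where C: "C > 0"
    and cap: "\<And>(v :: int ^ 'd \<Rightarrow> complex) E A. finite {x. v x \<noteq> 0} \<Longrightarrow> Q0 v \<le> ennreal E \<Longrightarrow> 0 \<le> E \<Longrightarrow>
      (\<And>x. x \<in> A \<Longrightarrow> 1 \<le> cmod (v x)) \<Longrightarrow> real (card A) powr (1 - \<alpha>) \<le> C * E"
    using isocapacitary_inequality[OF d] unfolding \<alpha>(3) by metis
  have "hardy_weight_lattice W \<and>
      hardy_const_lattice W \<le> (32 * C / (1 - \<alpha>)) * weak_lq_norm (real CARD('d) / 2) W"
    if W: "\<And>x. 0 \<le> W x" and weak: "W \<in> weak_lq (real CARD('d) / 2)" for W :: "int ^ 'd \<Rightarrow> real"
  proof -
    define N where "N = weak_lq_norm (real CARD('d) / 2) W"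
    have le_N: "s * real (card {x. W x > s}) powr \<alpha> \<le> N" if "0 < s" for s
      using cSUP_upper[of s "{0<..}" "\<lambda>s. s * real (distribution_count s W) powr \<alpha>"] weak that W
      by (simp add: N_def weak_lq_norm_def weak_lq_def \<alpha>_def distribution_count_def)
    have finite: "finite {x. W x > s}" if "0 < s" for s
    proof -
      have "(W \<longlongrightarrow> 0) cofinite" using weak by (simp add: weak_lq_def)
      then have "\<forall>\<^sub>F x in cofinite. W x < s" by (rule order_tendstoD(2)) (rule that)
      then have "finite {x. \<not> W x < s}" by (simp add: eventually_cofinite)
      then show ?thesis by (rule finite_subset[rotated]) auto
    qed
    have "0 \<le> 1 * real (card {x. W x > 1}) powr \<alpha>" by simp
    also have "\<dots> \<le> N" using le_N[of 1] by simp
    finally have N: "0 \<le> N" .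
    have weight: "(\<Sum>x\<in>A. W x) \<le> N / (1 - \<alpha>) * real (card A) powr (1 - \<alpha>)" if "finite A" for A
      by (rule sum_le_weak_bound[OF W \<alpha>(1,2) N _ that]) (use le_N finite in blast)
    have D: "0 \<le> N / (1 - \<alpha>)" using N \<alpha> by simp
    have bound: "(\<Sum>x\<in>F. W x * (cmod (\<phi> x))\<^sup>2) \<le> (16 * (N / (1 - \<alpha>)) * C) * E"
      if "finite {x. \<phi> x \<noteq> 0}" "Q0 \<phi> = ennreal E" "0 \<le> E" "finite F" for \<phi> E F
      by (rule hardy_inequality_from_weak_bound[OF W _ D weight cap that]) (use C \<alpha> in auto)
    have "0 \<le> 16 * (N / (1 - \<alpha>)) * C" using D C by (intro mult_nonneg_nonneg) auto
    then have "hardy_weight_lattice W" "hardy_const_lattice W \<le> 2 * (16 * (N / (1 - \<alpha>)) * C)"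
      using hardy_lattice_from_finite_support[OF W _ bound] by blast+
    then show ?thesis by (simp add: N_def mult_ac)
  qed
  with that show thesis by blast
qed

section \<open>Hardy weights on the lattice\<close>

theorem proposition4p4:
  assumes "CARD('d::finite) \<ge> 3"
  shows "(\<exists>C::real. \<forall>W :: int ^ 'd \<Rightarrow> real.
            (\<forall>x. 0 \<le> W x) \<longrightarrow> hardy_weight_euclidean (cell_extension W) \<longrightarrow>
            hardy_weight_lattice W \<and>
            hardy_const_lattice W \<le> C * hardy_const_euclidean (cell_extension W)) \<and>
         (\<exists>C::real. \<forall>W :: int ^ 'd \<Rightarrow> real.
            (\<forall>x. 0 \<le> W x) \<longrightarrow> W \<in> weak_lq (real CARD('d) / 2) \<longrightarrow>
            hardy_weight_lattice W \<and>
            hardy_const_lattice W \<le> C * weak_lq_norm (real CARD('d) / 2) W)"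
proof (rule conjI)
  obtain C :: real where "\<And>W :: int ^ 'd \<Rightarrow> real. (\<And>x. 0 \<le> W x) \<Longrightarrow>
      hardy_weight_euclidean (cell_extension W) \<Longrightarrow>
      hardy_weight_lattice W \<and>
      hardy_const_lattice W \<le> C * hardy_const_euclidean (cell_extension W)"
    using hardy_lattice_of_euclidean[where 'd = 'd] by metis
  then show "\<exists>C::real. \<forall>W :: int ^ 'd \<Rightarrow> real.
            (\<forall>x. 0 \<le> W x) \<longrightarrow> hardy_weight_euclidean (cell_extension W) \<longrightarrow>
            hardy_weight_lattice W \<and>
            hardy_const_lattice W \<le> C * hardy_const_euclidean (cell_extension W)"
    by blast
next
  obtain C :: real where "\<And>W :: int ^ 'd \<Rightarrow> real. (\<And>x. 0 \<le> W x) \<Longrightarrow>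
      W \<in> weak_lq (real CARD('d) / 2) \<Longrightarrow>
      hardy_weight_lattice W \<and> hardy_const_lattice W \<le> C * weak_lq_norm (real CARD('d) / 2) W"
    using hardy_lattice_of_weak_lq[OF assms] by metis
  then show "\<exists>C::real. \<forall>W :: int ^ 'd \<Rightarrow> real.
            (\<forall>x. 0 \<le> W x) \<longrightarrow> W \<in> weak_lq (real CARD('d) / 2) \<longrightarrow>
            hardy_weight_lattice W \<and>
            hardy_const_lattice W \<le> C * weak_lq_norm (real CARD('d) / 2) W"
    by blast
qed

end
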